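(* Let $D\ge1$, $d\ge 2$, $\ell_x\ge 1$ and $N_c\ge 3$ be integers. Let $\mathcal G=(\mathcal E,\{m_e\},\{d_i\})$ be a tensor network whose graph is a $D$-dimensional (hyper)cubic lattice with side lengths $L_x,L_y,L_z,\dots$ and with site dimensions $d_i\ge d$ for all sites $i$, such that: - in the $x$ direction, the network has periodic boundary conditions, bond dimension $m_x=d^{\ell_x}$ on all edges in $x$ direction, and length $L_x=2N_c\ell_x$; - in the other $D-1$ directions, the lengths $L_y,L_z,\dots\ge 1$ are arbitrary, the boundary conditions are arbitrary (open or periodic), and the bond dimensions $m_y,m_z,\dots\ge 2$ on the edges in the respective directions are arbitrary. Then the set $\mathrm{PEPS}(\mathcal G)$ of normalized projected entangled-pair states for $\mathcal G$ is not a closed subset of $\bigotimes_i\mathbb C^{d_i}$.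
   Context: The vertices of the lattice are the points of $\{1,\dots,L_x\}\times\{1,\dots,L_y\}\times\cdots$; edges join sites differing by one unit in exactly one coordinate, and periodic boundary conditions in a direction of length $L\ge3$ add edges joining the sites with coordinate $L$ and $1$ in that direction (the graph is simple; for $L\le 2$ periodic boundary conditions add nothing). Each $\mathbb C^{d_i}$ has orthonormal basis $\{|\sigma_i\rangle:\sigma_i=1,\dots,d_i\}$. Closedness is with respect to the norm topology. For a network $\mathcal G=(\mathcal E,\{m_e\},\{d_i\})$ (finite connected graph with edge set $\mathcal E$, bond dimensions $m_e$, site dimensions $d_i$) let $\partial i\subseteq\mathcal E$ be the set of edges incident to vertex $i$. A PEPS for $\mathcal G$ is obtained by assigning to each vertex $i$ a tensor $A_i\in\mathbb C^{d_i\times\prod_{e\in\partial i}m_e}$, with one physical index $\sigma_i$ and one bond index $n_e\in\{1,\dots,m_e\}$ for each $e\in\partial i$, and contracting: $$|\Psi\rangle=\sum_{\boldsymbol\sigma}\ \sum_{\{n_e\}_{e\in\mathcal E}}\ \prod_{i}[A_i^{\sigma_i}]_{(n_e)_{e\in\partial i}}\ |\boldsymbol\sigma\rangle .$$ $\mathrm{PEPS}(\mathcal G)$ is the set of all such states with $\|\Psi\|=1$. *)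

theory Defs
  imports "HOL-Analysis.Analysis"
begin

record 'v network =
  verts :: "'v set"
  edges :: "'v set set"
  bond_dim :: "'v set \<Rightarrow> nat"
  site_dim :: "'v \<Rightarrow> nat"

definition connected_graph :: "'v set \<Rightarrow> 'v set set \<Rightarrow> bool" where
  "connected_graph V E \<longleftrightarrow> V \<noteq> {} \<and> (\<forall>v\<in>V. \<forall>w\<in>V. (v, w) \<in> {(a, b). {a, b} \<in> E}\<^sup>*)"

definition tensor_network :: "'v network \<Rightarrow> bool" where
  "tensor_network G \<longleftrightarrow>
     finite (verts G) \<and> (\<forall>e\<in>edges G. e \<subseteq> verts G \<and> card e = 2) \<and>
     connected_graph (verts G) (edges G) \<and>
     (\<forall>e\<in>edges G. bond_dim G e \<ge> 1) \<and> (\<forall>v\<in>verts G. site_dim G v \<ge> 1)"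


section \<open>States\<close>

text \<open>
  A vector of the tensor product of the site spaces is represented by its coefficients in the
  product basis, whose elements are labelled by the configurations \<open>\<sigma>\<close> with
  \<open>\<sigma> i \<in> {1..site_dim G i}\<close>. Coefficients are 0 outside this index set, so that equality of
  vectors is equality of functions.
\<close>

definition configs :: "'v network \<Rightarrow> ('v \<Rightarrow> nat) set" where
  "configs G = (\<Pi>\<^sub>E i\<in>verts G. {1..site_dim G i})"

definition state_space :: "'v network \<Rightarrow> (('v \<Rightarrow> nat) \<Rightarrow> complex) set" where
  "state_space G = {\<Psi>. \<forall>\<sigma>. \<sigma> \<notin> configs G \<longrightarrow> \<Psi> \<sigma> = 0}"

definition state_norm :: "'v network \<Rightarrow> (('v \<Rightarrow> nat) \<Rightarrow> complex) \<Rightarrow> real" where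
  "state_norm G \<Psi> = L2_set (\<lambda>\<sigma>. cmod (\<Psi> \<sigma>)) (configs G)"

definition state_dist ::
    "'v network \<Rightarrow> (('v \<Rightarrow> nat) \<Rightarrow> complex) \<Rightarrow> (('v \<Rightarrow> nat) \<Rightarrow> complex) \<Rightarrow> real" where
  "state_dist G \<Psi> \<Phi> = state_norm G (\<lambda>\<sigma>. \<Psi> \<sigma> - \<Phi> \<sigma>)"

definition norm_topology :: "'v network \<Rightarrow> (('v \<Rightarrow> nat) \<Rightarrow> complex) topology" where
  "norm_topology G = Metric_space.mtopology (state_space G) (state_dist G)"


section \<open>Projected entangled-pair states\<close>

definition incident :: "'v network \<Rightarrow> 'v \<Rightarrow> 'v set set" where
  "incident G i = {e \<in> edges G. i \<in> e}"

definition bond_configs :: "'v network \<Rightarrow> ('v set \<Rightarrow> nat) set" where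
  "bond_configs G = (\<Pi>\<^sub>E e\<in>edges G. {1..bond_dim G e})"

text \<open>
  In \<open>A i s n\<close>, the tensor at site \<open>i\<close> has physical index \<open>s\<close> and bond indices
  \<open>n \<in> (\<Pi>\<^sub>E e\<in>incident G i. {1..bond_dim G e})\<close>. The contraction uses its entries only at
  indices in range.
\<close>

definition contract ::
    "'v network \<Rightarrow> ('v \<Rightarrow> nat \<Rightarrow> ('v set \<Rightarrow> nat) \<Rightarrow> complex) \<Rightarrow> ('v \<Rightarrow> nat) \<Rightarrow> complex" where
  "contract G A \<sigma> =
     (if \<sigma> \<in> configs G
      then \<Sum>n\<in>bond_configs G. \<Prod>i\<in>verts G. A i (\<sigma> i) (restrict n (incident G i))
      else 0)"

definition PEPS :: "'v network \<Rightarrow> (('v \<Rightarrow> nat) \<Rightarrow> complex) set" where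
  "PEPS G = {\<Psi>. (\<exists>A. \<Psi> = contract G A) \<and> state_norm G \<Psi> = 1}"


section \<open>Hypercubic lattices\<close>

text \<open>
  Directions are numbered \<open>0, \<dots>, D - 1\<close>, the \<open>x\<close> direction being 0; \<open>L k\<close> is the length in
  direction \<open>k\<close>, and \<open>per k\<close> says whether its boundary conditions are periodic.
\<close>

definition lattice_verts :: "nat \<Rightarrow> (nat \<Rightarrow> nat) \<Rightarrow> (nat \<Rightarrow> nat) set" where
  "lattice_verts D L = (\<Pi>\<^sub>E k\<in>{..<D}. {1..L k})"

definition lattice_edges_dir ::
    "nat \<Rightarrow> (nat \<Rightarrow> nat) \<Rightarrow> (nat \<Rightarrow> bool) \<Rightarrow> nat \<Rightarrow> (nat \<Rightarrow> nat) set set" where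
  "lattice_edges_dir D L per k =
     {{v, w} | v w. v \<in> lattice_verts D L \<and> w \<in> lattice_verts D L \<and>
        (\<forall>j<D. j \<noteq> k \<longrightarrow> v j = w j) \<and>
        (w k = v k + 1 \<or> per k \<and> L k \<ge> 3 \<and> v k = L k \<and> w k = 1)}"

definition lattice_edges ::
    "nat \<Rightarrow> (nat \<Rightarrow> nat) \<Rightarrow> (nat \<Rightarrow> bool) \<Rightarrow> (nat \<Rightarrow> nat) set set" where
  "lattice_edges D L per = (\<Union>k<D. lattice_edges_dir D L per k)"


section \<open>Consistency of the definitions\<close>

lemma finite_configs: "finite (verts G) \<Longrightarrow> finite (configs G)"
  unfolding configs_def by (simp add: finite_PiE)

lemma Metric_space_state_space:
  assumes "finite (verts G)"
  shows "Metric_space (state_space G) (state_dist G)"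
proof
  note fin = finite_configs[OF assms]
  fix x y z
  show "0 \<le> state_dist G x y"
    by (simp add: state_dist_def state_norm_def)
  show "state_dist G x y = state_dist G y x"
    by (simp add: state_dist_def state_norm_def norm_minus_commute)
  show "state_dist G x y = 0 \<longleftrightarrow> x = y" if "x \<in> state_space G" "y \<in> state_space G"
    using that fin
    by (auto simp: state_dist_def state_norm_def L2_set_eq_0_iff state_space_def fun_eq_iff)
  show "state_dist G x z \<le> state_dist G x y + state_dist G y z"
  proof -
    have "L2_set (\<lambda>\<sigma>. cmod (x \<sigma> - z \<sigma>)) (configs G)
        \<le> L2_set (\<lambda>\<sigma>. cmod (x \<sigma> - y \<sigma>) + cmod (y \<sigma> - z \<sigma>)) (configs G)"
      by (intro L2_set_mono) (auto intro: norm_diff_triangle_le)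
    also have "\<dots> \<le> L2_set (\<lambda>\<sigma>. cmod (x \<sigma> - y \<sigma>)) (configs G)
        + L2_set (\<lambda>\<sigma>. cmod (y \<sigma> - z \<sigma>)) (configs G)"
      by (rule L2_set_triangle_ineq)
    finally show ?thesis by (simp add: state_dist_def state_norm_def)
  qed
qed

lemma topspace_norm_topology:
  "finite (verts G) \<Longrightarrow> topspace (norm_topology G) = state_space G"
  unfolding norm_topology_def
  by (rule Metric_space.topspace_mtopology[OF Metric_space_state_space])

lemma PEPS_subset_state_space: "PEPS G \<subseteq> state_space G"
  by (auto simp: PEPS_def state_space_def contract_def)

lemma lattice_edge_card:
  assumes "e \<in> lattice_edges D L per"
  shows "e \<subseteq> lattice_verts D L" "card e = 2"
proof -
  from assms obtain k v w where "e = {v, w}" "v \<in> lattice_verts D L" "w \<in> lattice_verts D L"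
    "w k = v k + 1 \<or> per k \<and> L k \<ge> 3 \<and> v k = L k \<and> w k = 1"
    by (auto simp: lattice_edges_def lattice_edges_dir_def)
  moreover from this have "v \<noteq> w" by auto
  ultimately show "e \<subseteq> lattice_verts D L" "card e = 2" by auto
qed

lemma lattice_connected:
  assumes "\<And>k. k < D \<Longrightarrow> L k \<ge> 1"
  shows "connected_graph (lattice_verts D L) (lattice_edges D L per)"
proof -
  let ?R = "{(a, b). {a, b} \<in> lattice_edges D L per}"
  let ?o = "restrict (\<lambda>_. 1) {..<D} :: nat \<Rightarrow> nat"
  have o: "?o \<in> lattice_verts D L"
    using assms by (auto simp: lattice_verts_def)
  have "sym ?R" by (auto simp: sym_def insert_commute)
  then have symR: "sym (?R\<^sup>*)" by (rule sym_rtrancl)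
  have reach: "(v, ?o) \<in> ?R\<^sup>*" if "v \<in> lattice_verts D L" for v
    using that
  proof (induction "\<Sum>k<D. v k" arbitrary: v rule: less_induct)
    case less
    show ?case
    proof (cases "v = ?o")
      case False
      with less.prems obtain k where k: "k < D" "v k \<noteq> 1"
        by (metis (mono_tags, lifting) PiE_restrict lattice_verts_def lessThan_iff restrict_ext)
      with less.prems have vk: "1 < v k" "v k \<le> L k"
        by (auto simp: lattice_verts_def PiE_iff le_less)
      let ?u = "v(k := v k - 1)"
      have "v k - 1 \<in> {1..L k}" using vk by auto
      with less.prems k have u: "?u \<in> lattice_verts D L"
        unfolding lattice_verts_def by (auto simp: PiE_iff extensional_def)
      have "{?u, v} \<in> lattice_edges_dir D L per k"
        unfolding lattice_edges_dir_def using u less.prems vk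
        by (intro CollectI exI[of _ ?u] exI[of _ v]) auto
      with k have e: "(v, ?u) \<in> ?R" by (auto simp: lattice_edges_def insert_commute)
      have "(\<Sum>j<D. ?u j) < (\<Sum>j<D. v j)"
        using k vk by (intro sum_strict_mono_ex1) auto
      from less.hyps[OF this u] e show ?thesis
        by (rule converse_rtrancl_into_rtrancl[rotated])
    qed simp
  qed
  have "(v, w) \<in> ?R\<^sup>*" if "v \<in> lattice_verts D L" "w \<in> lattice_verts D L" for v w
    using reach[OF that(1)] symD[OF symR reach[OF that(2)]] by (rule rtrancl_trans)
  with o show ?thesis unfolding connected_graph_def by blast
qed

lemma tensor_network_lattice:
  assumes "verts G = lattice_verts D L" "edges G = lattice_edges D L per"
    and "\<And>k. k < D \<Longrightarrow> L k \<ge> 1"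
    and "\<And>e. e \<in> edges G \<Longrightarrow> bond_dim G e \<ge> 1" "\<And>v. v \<in> verts G \<Longrightarrow> site_dim G v \<ge> 1"
  shows "tensor_network G"
  using assms lattice_connected[of D L per] lattice_edge_card[of _ D L per]
  unfolding tensor_network_def by (auto simp: lattice_verts_def finite_PiE)

end

theory Submission
  imports Defs
begin

text \<open>
  Cut the \<open>x\<close> direction into three blocks, each containing at least \<open>2 * lx\<close> layers, and let \<open>M\<close> be
  the number of bond configurations of a cut. The blocks can carry the ring
  \<open>\<Sum> a b c. |a b\<rangle> |b c\<rangle> |c a\<rangle>\<close> of maximally entangled pairs, where \<open>a, b, c\<close> take \<open>M\<close> values.
  Colour these values with two colours, and multiply the term \<open>(a, b, c)\<close> by \<open>t\<close> for each of the
  pairs \<open>(a, b)\<close>, \<open>(b, c)\<close>, \<open>(c, a)\<close> of equal colour. Their number is 1 or 3, so dividing by \<open>t\<close>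
  and letting \<open>t \<rightarrow> 0\<close> leaves the sum over the triples that are not monochromatic.

  This limit is not a PEPS. Otherwise it would be a ring contraction of three blocks over bonds of
  dimension \<open>M\<close>. Its marginals on the first two blocks have full rank \<open>M\<^sup>2\<close>, so each of their two
  families of \<open>M \<times> M\<close> matrices \<open>B\<close> and \<open>B'\<close> spans all matrices. Fixing the third block to \<open>(a, a)\<close>
  turns the contraction into the trace of \<open>B B' P\<close> with \<open>P \<noteq> 0\<close>, a bilinear form of rank at least
  \<open>M\<close>. But the limit restricted to this value is the sum over the \<open>b\<close> that differ in colour from
  \<open>a\<close>, which has rank less than \<open>M\<close>.
\<close>

section \<open>Ring contractions of three matrices\<close>

text \<open>Gaussian elimination, by induction on the coordinates: a vector with a nonzero entry at
  \<open>j0\<close> serves as pivot and clears that coordinate from the others, which leaves one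
  vector and one coordinate fewer.\<close>

lemma nontrivial_relation:
  fixes B :: "'k \<Rightarrow> 'j \<Rightarrow> 'a::field"
  assumes "finite J" "finite K" "card J < card K"
  shows "\<exists>c. (\<exists>k\<in>K. c k \<noteq> 0) \<and> (\<forall>j\<in>J. (\<Sum>k\<in>K. c k * B k j) = 0)"
  using assms
proof (induction J arbitrary: K B rule: finite_induct)
  case empty
  then have "K \<noteq> {}" by auto
  then show ?case by (intro exI[of _ "\<lambda>_. 1"]) auto
next
  case (insert j0 J)
  show ?case
  proof (cases "\<forall>k\<in>K. B k j0 = 0")
    case True
    then show ?thesis using insert.IH[of K B] insert.prems insert.hyps by auto
  next
    case False
    then obtain k0 where k0: "k0 \<in> K" "B k0 j0 \<noteq> 0" by auto
    define q where "q k = B k j0 / B k0 j0" for k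
    have "card J < card (K - {k0})" using insert k0 by simp
    then obtain c where c: "\<exists>k\<in>K - {k0}. c k \<noteq> 0"
      "\<forall>j\<in>J. (\<Sum>k\<in>K - {k0}. c k * (B k j - q k * B k0 j)) = 0"
      using insert.IH[of "K - {k0}" "\<lambda>k j. B k j - q k * B k0 j"] insert.prems by auto
    \<comment> \<open>The pivot's coefficient collects the multiples subtracted in the elimination,
      so a relation of the reduced vectors becomes one of the original vectors.\<close>
    define c' where "c' = c(k0 := - (\<Sum>k\<in>K - {k0}. c k * q k))"
    have sum: "(\<Sum>k\<in>K. c' k * B k j) = (\<Sum>k\<in>K - {k0}. c k * (B k j - q k * B k0 j))" for j
    proof -
      have "(\<Sum>k\<in>K. c' k * B k j) = c' k0 * B k0 j + (\<Sum>k\<in>K - {k0}. c' k * B k j)"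
        using k0 insert.prems by (simp add: sum.remove)
      also have "(\<Sum>k\<in>K - {k0}. c' k * B k j) = (\<Sum>k\<in>K - {k0}. c k * B k j)"
        by (intro sum.cong) (auto simp: c'_def)
      finally show ?thesis
        by (simp add: c'_def right_diff_distrib sum_subtractf sum_distrib_right mult.assoc)
    qed
    have "(\<Sum>k\<in>K. c' k * B k j0) = 0"
      unfolding sum using k0 by (simp add: q_def)
    moreover have "\<exists>k\<in>K. c' k \<noteq> 0" using c(1) by (auto simp: c'_def)
    ultimately show ?thesis using c(2) sum by (intro exI[of _ c']) auto
  qed
qed

text \<open>Adjoining \<open>f\<close> gives more vectors than coordinates, hence a relation.
  Independence makes the coefficient of \<open>f\<close> nonzero, and the relation is solved for
  \<open>f\<close>.\<close>

lemma independent_imp_spanning: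
  fixes B :: "'k \<Rightarrow> 'j \<Rightarrow> 'a::field"
  assumes fin: "finite J" "finite K" and card: "card K = card J"
    and indep: "\<And>c. (\<And>j. j \<in> J \<Longrightarrow> (\<Sum>k\<in>K. c k * B k j) = 0) \<Longrightarrow> \<forall>k\<in>K. c k = 0"
  shows "\<exists>c. \<forall>j\<in>J. (\<Sum>k\<in>K. c k * B k j) = f j"
proof -
  \<comment> \<open>The index \<open>None\<close> stands for the adjoined vector
    \<open>f\<close>.\<close>
  let ?K = "insert None (Some ` K)"
  let ?B = "\<lambda>k. case k of None \<Rightarrow> f | Some k \<Rightarrow> B k"
  have "card J < card ?K" using fin card by (simp add: card_image)
  then obtain c where c: "\<exists>k\<in>?K. c k \<noteq> 0" "\<forall>j\<in>J. (\<Sum>k\<in>?K. c k * ?B k j) = 0"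
    using nontrivial_relation[of J ?K ?B] fin by auto
  have rel: "c None * f j + (\<Sum>k\<in>K. c (Some k) * B k j) = 0" if "j \<in> J" for j
    using c(2) that fin by (simp add: sum.reindex)
  have "c None \<noteq> 0"
  proof
    assume "c None = 0"
    with rel indep[of "\<lambda>k. c (Some k)"] have "\<forall>k\<in>K. c (Some k) = 0" by simp
    with c(1) \<open>c None = 0\<close> show False by auto
  qed
  have "(\<Sum>k\<in>K. - c (Some k) / c None * B k j) = f j" if "j \<in> J" for j
  proof -
    have "(\<Sum>k\<in>K. - c (Some k) / c None * B k j) = - (\<Sum>k\<in>K. c (Some k) * B k j) / c None"
      by (simp add: sum_negf sum_divide_distrib)
    also have "- (\<Sum>k\<in>K. c (Some k) * B k j) = c None * f j"
      using rel[OF that] by (simp add: neg_eq_iff_add_eq_0 add.commute)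
    finally show ?thesis using \<open>c None \<noteq> 0\<close> by simp
  qed
  then show ?thesis by (intro exI[of _ "\<lambda>k. - c (Some k) / c None"]) auto
qed

section \<open>Traces of products of three matrices\<close>

text \<open>The trace of the matrix product \<open>P Q R\<close>, for rectangular matrices indexed
  by arbitrary sets.\<close>

definition ring_sum ::
    "'i set \<Rightarrow> 'j set \<Rightarrow> 'k set \<Rightarrow> ('i \<Rightarrow> 'j \<Rightarrow> 'a) \<Rightarrow> ('j \<Rightarrow> 'k \<Rightarrow> 'a) \<Rightarrow> ('k \<Rightarrow> 'i \<Rightarrow> 'a) \<Rightarrow> 'a::field" where
  "ring_sum I J K P Q R = (\<Sum>\<alpha>\<in>I. \<Sum>\<beta>\<in>J. \<Sum>\<gamma>\<in>K. P \<alpha> \<beta> * Q \<beta> \<gamma> * R \<gamma> \<alpha>)"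

text \<open>Cyclicity of the trace. Linearity then has to be proved in the first factor only, since
  the other factors can be rotated there.\<close>

lemma ring_sum_rotate: "ring_sum I J K P Q R = ring_sum J K I Q R P"
proof -
  have "ring_sum I J K P Q R = (\<Sum>\<beta>\<in>J. \<Sum>\<alpha>\<in>I. \<Sum>\<gamma>\<in>K. P \<alpha> \<beta> * Q \<beta> \<gamma> * R \<gamma> \<alpha>)"
    unfolding ring_sum_def by (rule sum.swap)
  also have "\<dots> = (\<Sum>\<beta>\<in>J. \<Sum>\<gamma>\<in>K. \<Sum>\<alpha>\<in>I. P \<alpha> \<beta> * Q \<beta> \<gamma> * R \<gamma> \<alpha>)"
    by (rule sum.cong[OF refl sum.swap])
  also have "\<dots> = ring_sum J K I Q R P"
    unfolding ring_sum_def by (intro sum.cong refl) (simp only: mult_ac)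
  finally show ?thesis .
qed

lemma ring_sum_combine:
  "(\<Sum>x\<in>X. c x * ring_sum I J K (P x) Q R) = ring_sum I J K (\<lambda>\<alpha> \<beta>. \<Sum>x\<in>X. c x * P x \<alpha> \<beta>) Q R"
proof -
  have "(\<Sum>x\<in>X. c x * ring_sum I J K (P x) Q R)
      = (\<Sum>x\<in>X. \<Sum>\<alpha>\<in>I. \<Sum>\<beta>\<in>J. \<Sum>\<gamma>\<in>K. c x * P x \<alpha> \<beta> * Q \<beta> \<gamma> * R \<gamma> \<alpha>)"
    unfolding ring_sum_def by (simp add: sum_distrib_left mult.assoc)
  also have "\<dots> = (\<Sum>\<alpha>\<in>I. \<Sum>x\<in>X. \<Sum>\<beta>\<in>J. \<Sum>\<gamma>\<in>K. c x * P x \<alpha> \<beta> * Q \<beta> \<gamma> * R \<gamma> \<alpha>)"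
    by (rule sum.swap)
  also have "\<dots> = (\<Sum>\<alpha>\<in>I. \<Sum>\<beta>\<in>J. \<Sum>x\<in>X. \<Sum>\<gamma>\<in>K. c x * P x \<alpha> \<beta> * Q \<beta> \<gamma> * R \<gamma> \<alpha>)"
    by (intro sum.cong refl sum.swap)
  also have "\<dots> = (\<Sum>\<alpha>\<in>I. \<Sum>\<beta>\<in>J. \<Sum>\<gamma>\<in>K. \<Sum>x\<in>X. c x * P x \<alpha> \<beta> * Q \<beta> \<gamma> * R \<gamma> \<alpha>)"
    by (intro sum.cong refl sum.swap)
  finally show ?thesis unfolding ring_sum_def by (simp add: sum_distrib_right)
qed

lemma ring_sum_cong:
  assumes "\<And>\<alpha> \<beta>. \<alpha> \<in> I \<Longrightarrow> \<beta> \<in> J \<Longrightarrow> P \<alpha> \<beta> = P' \<alpha> \<beta>"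
    and "\<And>\<beta> \<gamma>. \<beta> \<in> J \<Longrightarrow> \<gamma> \<in> K \<Longrightarrow> Q \<beta> \<gamma> = Q' \<beta> \<gamma>"
    and "\<And>\<gamma> \<alpha>. \<gamma> \<in> K \<Longrightarrow> \<alpha> \<in> I \<Longrightarrow> R \<gamma> \<alpha> = R' \<gamma> \<alpha>"
  shows "ring_sum I J K P Q R = ring_sum I J K P' Q' R'"
  using assms unfolding ring_sum_def by (intro sum.cong refl) auto

text \<open>By \<open>iso\<close>, every \<open>s\<close> has a linear functional that vanishes on
  the family except at \<open>B1 s\<close>. So the family is independent, and as it has as many
  members as a matrix has entries, it spans.\<close>

lemma ring_block_spanning:
  fixes B1 :: "'s \<Rightarrow> 'i \<Rightarrow> 'j \<Rightarrow> 'a::field"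
  assumes fin: "finite I" "finite J" "finite S" and card: "card S = card I * card J"
    and iso: "\<And>s. s \<in> S \<Longrightarrow> \<exists>Q R. \<forall>s'\<in>S. ring_sum I J K (B1 s') Q R = (if s' = s then \<kappa> else 0)"
    and \<kappa>: "\<kappa> \<noteq> 0"
  shows "\<exists>c. \<forall>\<alpha>\<in>I. \<forall>\<beta>\<in>J. (\<Sum>s\<in>S. c s * B1 s \<alpha> \<beta>) = f \<alpha> \<beta>"
proof -
  have "\<exists>c. \<forall>j\<in>I \<times> J. (\<Sum>s\<in>S. c s * case_prod (B1 s) j) = case_prod f j"
  proof (rule independent_imp_spanning)
    show "finite (I \<times> J)" "finite S" "card S = card (I \<times> J)"
      using assms by (auto simp: card_cartesian_product)
    fix c :: "'s \<Rightarrow> 'a"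
    assume 0: "\<And>j. j \<in> I \<times> J \<Longrightarrow> (\<Sum>s\<in>S. c s * case_prod (B1 s) j) = 0"
    show "\<forall>s\<in>S. c s = 0"
    proof
      fix s assume s: "s \<in> S"
      then obtain Q R where QR: "\<forall>s'\<in>S. ring_sum I J K (B1 s') Q R = (if s' = s then \<kappa> else 0)"
        using iso by blast
      have "c s * \<kappa> = (\<Sum>s'\<in>S. if s' = s then c s' * \<kappa> else 0)"
        using s fin by simp
      also have "\<dots> = (\<Sum>s'\<in>S. c s' * ring_sum I J K (B1 s') Q R)"
        using QR by (intro sum.cong) auto
      also have "\<dots> = ring_sum I J K (\<lambda>\<alpha> \<beta>. 0) Q R"
        unfolding ring_sum_combine using 0 by (intro ring_sum_cong) auto
      finally show "c s = 0" using \<kappa> by (simp add: ring_sum_def)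
    qed
  qed
  then show ?thesis by auto
qed

text \<open>The first two factors are matrix units, so their product is a matrix unit or 0.\<close>

lemma ring_sum_delta:
  assumes "finite I" "finite J" "finite K" "\<alpha>0 \<in> I" "\<beta>0 \<in> J" "\<beta>1 \<in> J" "\<gamma>0 \<in> K"
  shows "ring_sum I J K (\<lambda>\<alpha> \<beta>. if \<alpha> = \<alpha>0 \<and> \<beta> = \<beta>0 then 1 else 0)
      (\<lambda>\<beta> \<gamma>. if \<beta> = \<beta>1 \<and> \<gamma> = \<gamma>0 then 1 else 0) R = (if \<beta>0 = \<beta>1 then R \<gamma>0 \<alpha>0 else 0)"
proof -
  have "ring_sum I J K (\<lambda>\<alpha> \<beta>. if \<alpha> = \<alpha>0 \<and> \<beta> = \<beta>0 then 1 else 0)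
      (\<lambda>\<beta> \<gamma>. if \<beta> = \<beta>1 \<and> \<gamma> = \<gamma>0 then 1 else 0) R
    = (\<Sum>\<alpha>\<in>I. if \<alpha> = \<alpha>0 then \<Sum>\<beta>\<in>J. if \<beta> = \<beta>0 then \<Sum>\<gamma>\<in>K. if \<gamma> = \<gamma>0
         then (if \<beta>0 = \<beta>1 then R \<gamma>0 \<alpha>0 else 0) else 0 else 0 else 0)"
    unfolding ring_sum_def by (auto intro!: sum.cong sum.neutral)
  then show ?thesis using assms by simp
qed

text \<open>A rank argument. Since the first two blocks span, combinations of them give all matrix
  units, and with the third block fixed the trace yields a nonzero multiple of the identity matrix
  on \<open>J\<close>. By \<open>eq\<close> this matrix factors through the values coloured
  differently from \<open>a0\<close>, which are fewer than \<open>card J\<close>.\<close>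

lemma degenerate_ring_not_representable:
  fixes B1 :: "'s \<Rightarrow> 's \<Rightarrow> 'i \<Rightarrow> 'j \<Rightarrow> 'a::field" and B2 :: "'s \<Rightarrow> 's \<Rightarrow> 'j \<Rightarrow> 'k \<Rightarrow> 'a"
    and B3 :: "'s \<Rightarrow> 's \<Rightarrow> 'k \<Rightarrow> 'i \<Rightarrow> 'a" and \<phi> :: "'s \<Rightarrow> 'c"
  assumes fin: "finite S" "finite I" "finite J" "finite K"
    and card: "card I = card S" "card J = card S" "card K = card S"
    and colours: "a0 \<in> S" "a1 \<in> S" "\<phi> a0 \<noteq> \<phi> a1" and \<kappa>: "\<kappa> \<noteq> 0"
    and eq: "\<And>a b b' c c' a'. {a, b, b', c, c', a'} \<subseteq> S \<Longrightarrow>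
      ring_sum I J K (B1 a b) (B2 b' c) (B3 c' a')
        = (if b = b' \<and> c = c' \<and> a = a' \<and> \<not> (\<phi> a = \<phi> b \<and> \<phi> b = \<phi> c) then \<kappa> else 0)"
  shows False
proof -
  have other: "\<exists>x\<in>S. \<phi> x \<noteq> \<phi> y" for y using colours by metis
  have span1: "\<exists>s. \<forall>\<alpha>\<in>I. \<forall>\<beta>\<in>J. (\<Sum>x\<in>S \<times> S. s x * case_prod B1 x \<alpha> \<beta>) = f \<alpha> \<beta>" for f
  proof (rule ring_block_spanning[where K = K and \<kappa> = \<kappa>])
    fix x assume "x \<in> S \<times> S"
    then obtain a b where x: "x = (a, b)" "a \<in> S" "b \<in> S" by auto
    \<comment> \<open>With this \<open>c\<close> the triple \<open>(a, b, c)\<close> is not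
      monochromatic, whatever \<open>b\<close> is.\<close>
    obtain c where c: "c \<in> S" "\<phi> c \<noteq> \<phi> a" using other by blast
    show "\<exists>Q R. \<forall>x'\<in>S \<times> S. ring_sum I J K (case_prod B1 x') Q R = (if x' = x then \<kappa> else 0)"
      using x c by (intro exI[of _ "B2 b c"] exI[of _ "B3 c a"]) (auto simp: eq)
  qed (use fin card \<kappa> in \<open>auto simp: card_cartesian_product\<close>)
  have span2: "\<exists>s. \<forall>\<beta>\<in>J. \<forall>\<gamma>\<in>K. (\<Sum>x\<in>S \<times> S. s x * case_prod B2 x \<beta> \<gamma>) = f \<beta> \<gamma>" for f
  proof (rule ring_block_spanning[where K = I and \<kappa> = \<kappa>])
    fix x assume "x \<in> S \<times> S"
    then obtain b c where x: "x = (b, c)" "b \<in> S" "c \<in> S" by auto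
    obtain a where a: "a \<in> S" "\<phi> a \<noteq> \<phi> b" using other by blast
    show "\<exists>Q R. \<forall>x'\<in>S \<times> S. ring_sum J K I (case_prod B2 x') Q R = (if x' = x then \<kappa> else 0)"
      using x a unfolding ring_sum_rotate[of I J K, symmetric]
      by (intro exI[of _ "B3 c a"] exI[of _ "B1 a b"]) (auto simp: eq)
  qed (use fin card \<kappa> in \<open>auto simp: card_cartesian_product\<close>)
  \<comment> \<open>The third block is frozen at the pair \<open>(a0, a0)\<close>. It is not the
    zero matrix, because the triple \<open>(a0, a1, a0)\<close> is not monochromatic.\<close>
  define P where "P = B3 a0 a0"
  have "\<exists>\<gamma>\<in>K. \<exists>\<alpha>\<in>I. P \<gamma> \<alpha> \<noteq> 0"
  proof (rule ccontr)
    assume "\<not> ?thesis"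
    then have "ring_sum I J K (B1 a0 a1) (B2 a1 a0) P = 0"
      by (auto simp: ring_sum_def)
    with eq[of a0 a1 a1 a0 a0 a0] colours \<kappa> show False by (simp add: P_def)
  qed
  then obtain \<gamma>0 \<alpha>0 where P: "\<gamma>0 \<in> K" "\<alpha>0 \<in> I" "P \<gamma>0 \<alpha>0 \<noteq> 0" by blast
  \<comment> \<open>Coefficients that produce the matrix units at
    \<open>(\<alpha>0, \<beta>0)\<close> and \<open>(\<beta>1, \<gamma>0)\<close>. The outer indices
    are those of a nonzero entry of \<open>P\<close>; the inner ones range freely over
    \<open>J\<close>.\<close>
  have "\<forall>\<beta>0. \<exists>s. \<forall>\<alpha>\<in>I. \<forall>\<beta>\<in>J.
      (\<Sum>x\<in>S \<times> S. s x * case_prod B1 x \<alpha> \<beta>) = (if \<alpha> = \<alpha>0 \<and> \<beta> = \<beta>0 then 1 else 0)"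
    by (intro allI span1)
  from choice[OF this] obtain s where s: "\<forall>\<beta>0. \<forall>\<alpha>\<in>I. \<forall>\<beta>\<in>J.
      (\<Sum>x\<in>S \<times> S. s \<beta>0 x * case_prod B1 x \<alpha> \<beta>) = (if \<alpha> = \<alpha>0 \<and> \<beta> = \<beta>0 then 1 else 0)" ..
  have "\<forall>\<beta>1. \<exists>u. \<forall>\<beta>\<in>J. \<forall>\<gamma>\<in>K.
      (\<Sum>x\<in>S \<times> S. u x * case_prod B2 x \<beta> \<gamma>) = (if \<beta> = \<beta>1 \<and> \<gamma> = \<gamma>0 then 1 else 0)"
    by (intro allI span2)
  from choice[OF this] obtain u where u: "\<forall>\<beta>1. \<forall>\<beta>\<in>J. \<forall>\<gamma>\<in>K.
      (\<Sum>x\<in>S \<times> S. u \<beta>1 x * case_prod B2 x \<beta> \<gamma>) = (if \<beta> = \<beta>1 \<and> \<gamma> = \<gamma>0 then 1 else 0)" ..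
  \<comment> \<open>The middle values that survive between \<open>a0\<close> and \<open>a0\<close>.
    Since \<open>a0\<close> is not among them, \<open>S'\<close> is smaller than \<open>S\<close>
    and hence than \<open>J\<close>.\<close>
  define S' where "S' = {b \<in> S. \<phi> b \<noteq> \<phi> a0}"
  \<comment> \<open>One double linear combination is evaluated twice: \<open>eq\<close> turns it
    into a sum over \<open>S'\<close>, and linearity into the trace of two matrix units and
    \<open>P\<close>.\<close>
  have factor: "(\<Sum>b\<in>S'. s \<beta>0 (a0, b) * (\<kappa> * u \<beta>1 (b, a0))) = (if \<beta>0 = \<beta>1 then P \<gamma>0 \<alpha>0 else 0)"
    if "\<beta>0 \<in> J" "\<beta>1 \<in> J" for \<beta>0 \<beta>1
  proof -
    have val: "ring_sum I J K (B1 a b) (B2 b' c) P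
        = (if (b', c) = (b, a0) \<and> a = a0 \<and> b \<in> S' then \<kappa> else 0)"
      if "a \<in> S" "b \<in> S" "b' \<in> S" "c \<in> S" for a b b' c
    proof -
      have "ring_sum I J K (B1 a b) (B2 b' c) P
          = (if b = b' \<and> c = a0 \<and> a = a0 \<and> \<not> (\<phi> a = \<phi> b \<and> \<phi> b = \<phi> c) then \<kappa> else 0)"
        unfolding P_def using that colours(1) by (intro eq) blast
      moreover have "b = b' \<and> c = a0 \<and> a = a0 \<and> \<not> (\<phi> a = \<phi> b \<and> \<phi> b = \<phi> c)
          \<longleftrightarrow> (b', c) = (b, a0) \<and> a = a0 \<and> b \<in> S'"
        using that unfolding S'_def prod.inject mem_Collect_eq by metis
      ultimately show ?thesis by (simp only:)
    qed
    have in1: "(\<Sum>y\<in>S \<times> S. u \<beta>1 y * ring_sum I J K (B1 a b) (case_prod B2 y) P)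
        = (if a = a0 then if b \<in> S' then \<kappa> * u \<beta>1 (b, a0) else 0 else 0)" if "a \<in> S" "b \<in> S" for a b
    proof -
      have "(\<Sum>y\<in>S \<times> S. u \<beta>1 y * ring_sum I J K (B1 a b) (case_prod B2 y) P)
        = (\<Sum>y\<in>S \<times> S. if y = (b, a0) then if a = a0 then if b \<in> S' then \<kappa> * u \<beta>1 (b, a0) else 0 else 0 else 0)"
      proof (rule sum.cong[OF refl])
        fix y assume "y \<in> S \<times> S"
        then obtain b' c where "y = (b', c)" "b' \<in> S" "c \<in> S" by blast
        then show "u \<beta>1 y * ring_sum I J K (B1 a b) (case_prod B2 y) P
          = (if y = (b, a0) then if a = a0 then if b \<in> S' then \<kappa> * u \<beta>1 (b, a0) else 0 else 0 else 0)"
          using val[of a b b' c] that by simp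
      qed
      then show ?thesis using that colours fin by (simp add: finite_cartesian_product)
    qed
    have "(\<Sum>x\<in>S \<times> S. s \<beta>0 x * (\<Sum>y\<in>S \<times> S. u \<beta>1 y * ring_sum I J K (case_prod B1 x) (case_prod B2 y) P))
        = (\<Sum>a\<in>S. \<Sum>b\<in>S. if a = a0 then if b \<in> S' then s \<beta>0 (a, b) * (\<kappa> * u \<beta>1 (b, a0)) else 0 else 0)"
      unfolding sum.cartesian_product
    proof (rule sum.cong[OF refl])
      fix x assume "x \<in> S \<times> S"
      then obtain a b where "x = (a, b)" "a \<in> S" "b \<in> S" by blast
      then show "s \<beta>0 x * (\<Sum>y\<in>S \<times> S. u \<beta>1 y * ring_sum I J K (case_prod B1 x) (case_prod B2 y) P)
        = (case x of (a, b) \<Rightarrow> if a = a0 then if b \<in> S' then s \<beta>0 (a, b) * (\<kappa> * u \<beta>1 (b, a0)) else 0 else 0)"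
        using in1[of a b] by simp
    qed
    also have "\<dots> = (\<Sum>a\<in>S. if a = a0 then \<Sum>b\<in>S. if b \<in> S' then s \<beta>0 (a, b) * (\<kappa> * u \<beta>1 (b, a0)) else 0 else 0)"
      by (intro sum.cong) auto
    also have "\<dots> = (\<Sum>b\<in>S. if b \<in> S' then s \<beta>0 (a0, b) * (\<kappa> * u \<beta>1 (b, a0)) else 0)"
      using fin colours by simp
    also have "\<dots> = (\<Sum>b\<in>S'. s \<beta>0 (a0, b) * (\<kappa> * u \<beta>1 (b, a0)))"
      using fin by (intro sum.mono_neutral_cong_right) (auto simp: S'_def)
    finally have "(\<Sum>b\<in>S'. s \<beta>0 (a0, b) * (\<kappa> * u \<beta>1 (b, a0)))
      = (\<Sum>x\<in>S \<times> S. s \<beta>0 x * (\<Sum>y\<in>S \<times> S. u \<beta>1 y * ring_sum I J K (case_prod B1 x) (case_prod B2 y) P))" ..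
    also have "\<dots> = (\<Sum>x\<in>S \<times> S. s \<beta>0 x * ring_sum I J K (case_prod B1 x)
        (\<lambda>\<beta> \<gamma>. if \<beta> = \<beta>1 \<and> \<gamma> = \<gamma>0 then 1 else 0) P)"
      unfolding ring_sum_rotate[of I J K] ring_sum_combine
      by (intro sum.cong refl arg_cong2[of _ _ _ _ "(*)"] ring_sum_cong) (auto simp: u)
    also have "\<dots> = ring_sum I J K (\<lambda>\<alpha> \<beta>. if \<alpha> = \<alpha>0 \<and> \<beta> = \<beta>0 then 1 else 0)
        (\<lambda>\<beta> \<gamma>. if \<beta> = \<beta>1 \<and> \<gamma> = \<gamma>0 then 1 else 0) P"
      unfolding ring_sum_combine by (intro ring_sum_cong) (auto simp: s)
    also have "\<dots> = (if \<beta>0 = \<beta>1 then P \<gamma>0 \<alpha>0 else 0)"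
      using fin P that by (intro ring_sum_delta) auto
    finally show ?thesis .
  qed
  have "card S' < card J"
    unfolding card(2) using fin colours by (intro psubset_card_mono) (auto simp: S'_def)
  moreover have "finite S'" using fin by (simp add: S'_def)
  \<comment> \<open>The left factor in \<open>factor\<close> has more rows than columns, so a
    nonzero \<open>x\<close> annihilates it; but the product is a nonzero multiple of the
    identity.\<close>
  ultimately obtain x where x: "\<exists>\<beta>\<in>J. x \<beta> \<noteq> 0" "\<forall>b\<in>S'. (\<Sum>\<beta>\<in>J. x \<beta> * s \<beta> (a0, b)) = 0"
    using nontrivial_relation[of S' J "\<lambda>\<beta> b. s \<beta> (a0, b)"] fin by auto
  then obtain \<beta>1 where \<beta>1: "\<beta>1 \<in> J" "x \<beta>1 \<noteq> 0" by auto
  have "x \<beta>1 * P \<gamma>0 \<alpha>0 = (\<Sum>\<beta>\<in>J. if \<beta> = \<beta>1 then x \<beta> * P \<gamma>0 \<alpha>0 else 0)"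
    using \<beta>1 fin by simp
  also have "\<dots> = (\<Sum>\<beta>\<in>J. x \<beta> * (\<Sum>b\<in>S'. s \<beta> (a0, b) * (\<kappa> * u \<beta>1 (b, a0))))"
    using \<beta>1 by (intro sum.cong) (auto simp: factor)
  also have "\<dots> = (\<Sum>b\<in>S'. (\<Sum>\<beta>\<in>J. x \<beta> * s \<beta> (a0, b)) * (\<kappa> * u \<beta>1 (b, a0)))"
    unfolding sum_distrib_left sum_distrib_right by (subst sum.swap) (simp add: mult_ac)
  also have "\<dots> = 0" using x(2) by simp
  finally show False using \<beta>1 P by simp
qed


section \<open>Grouping a network into three blocks\<close>

lemma sum_PiE_Un:
  assumes "A \<inter> B = {}"
  shows "(\<Sum>n\<in>Pi\<^sub>E (A \<union> B) F. f n)
    = (\<Sum>a\<in>Pi\<^sub>E A F. \<Sum>b\<in>Pi\<^sub>E B F. f (\<lambda>e. if e \<in> A then a e else b e))"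
  unfolding sum.cartesian_product
proof (rule sum.reindex_bij_witness[where
      i = "\<lambda>(a, b) e. if e \<in> A then a e else b e" and j = "\<lambda>n. (restrict n A, restrict n B)"])
  fix n assume n: "n \<in> Pi\<^sub>E (A \<union> B) F"
  then have *: "(\<lambda>e. if e \<in> A then restrict n A e else restrict n B e) = n"
    by (auto simp: fun_eq_iff PiE_iff extensional_def)
  then show "(case (restrict n A, restrict n B) of (a, b) \<Rightarrow> \<lambda>e. if e \<in> A then a e else b e) = n"
    by simp
  show "(restrict n A, restrict n B) \<in> Pi\<^sub>E A F \<times> Pi\<^sub>E B F" using n by auto
  show "(case (restrict n A, restrict n B) of (a, b) \<Rightarrow> f (\<lambda>e. if e \<in> A then a e else b e)) = f n"
    using * by simp
next
  fix x assume "x \<in> Pi\<^sub>E A F \<times> Pi\<^sub>E B F"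
  then obtain a b where x: "x = (a, b)" "a \<in> Pi\<^sub>E A F" "b \<in> Pi\<^sub>E B F" by auto
  show "(case x of (a, b) \<Rightarrow> \<lambda>e. if e \<in> A then a e else b e) \<in> Pi\<^sub>E (A \<union> B) F"
    using x by (auto simp: PiE_iff extensional_def)
  show "(restrict (case x of (a, b) \<Rightarrow> \<lambda>e. if e \<in> A then a e else b e) A,
      restrict (case x of (a, b) \<Rightarrow> \<lambda>e. if e \<in> A then a e else b e) B) = x"
    using x assms by (auto simp: fun_eq_iff PiE_iff extensional_def)
qed

definition edge_configs :: "'v network \<Rightarrow> 'v set set \<Rightarrow> ('v set \<Rightarrow> nat) set" where
  "edge_configs G E = (\<Pi>\<^sub>E e\<in>E. {1..bond_dim G e})"

definition cut :: "'v network \<Rightarrow> 'v set \<Rightarrow> 'v set \<Rightarrow> 'v set set" where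
  "cut G V W = {e \<in> edges G. e \<inter> V \<noteq> {} \<and> e \<inter> W \<noteq> {}}"

definition inner_edges :: "'v network \<Rightarrow> 'v set \<Rightarrow> 'v set set" where
  "inner_edges G V = {e \<in> edges G. e \<subseteq> V}"

text \<open>The boundary edges of the block \<open>V\<close> are split into \<open>C\<close>, with bond indices \<open>\<alpha>\<close>, and
  the rest, with bond indices \<open>\<beta>\<close>.\<close>

definition block_tensor ::
    "'v network \<Rightarrow> ('v \<Rightarrow> nat \<Rightarrow> ('v set \<Rightarrow> nat) \<Rightarrow> complex) \<Rightarrow> 'v set \<Rightarrow> 'v set set
      \<Rightarrow> ('v \<Rightarrow> nat) \<Rightarrow> ('v set \<Rightarrow> nat) \<Rightarrow> ('v set \<Rightarrow> nat) \<Rightarrow> complex" where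
  "block_tensor G A V C \<sigma> \<alpha> \<beta> =
    (\<Sum>n\<in>edge_configs G (inner_edges G V). \<Prod>i\<in>V. A i (\<sigma> i)
       (restrict (\<lambda>e. if e \<in> inner_edges G V then n e else if e \<in> C then \<alpha> e else \<beta> e) (incident G i)))"

text \<open>Allows the configuration outside a block to be replaced at will.\<close>

lemma block_tensor_cong:
  "(\<And>i. i \<in> V \<Longrightarrow> \<sigma> i = \<tau> i) \<Longrightarrow> block_tensor G A V C \<sigma> = block_tensor G A V C \<tau>"
  by (auto simp: block_tensor_def fun_eq_iff intro!: sum.cong prod.cong)

text \<open>An edge has two ends, so it is inner to one block or lies in exactly one of the three
  cuts. Summing over the inner bonds first merges each block into one tensor, and the sums over the
  cuts remain.\<close>

lemma contract_three_blocks: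
  assumes G: "tensor_network G"
    and V: "verts G = V1 \<union> V2 \<union> V3" "V1 \<inter> V2 = {}" "V2 \<inter> V3 = {}" "V1 \<inter> V3 = {}"
    and \<sigma>: "\<sigma> \<in> configs G"
  shows "contract G A \<sigma> = ring_sum (edge_configs G (cut G V3 V1)) (edge_configs G (cut G V1 V2))
      (edge_configs G (cut G V2 V3)) (block_tensor G A V1 (cut G V3 V1) \<sigma>)
      (block_tensor G A V2 (cut G V1 V2) \<sigma>) (block_tensor G A V3 (cut G V2 V3) \<sigma>)"
proof -
  let ?Ca = "cut G V3 V1" and ?Cb = "cut G V1 V2" and ?Cc = "cut G V2 V3"
  let ?E1 = "inner_edges G V1" and ?E2 = "inner_edges G V2" and ?E3 = "inner_edges G V3"
  define F where "F = (\<lambda>e. {1..bond_dim G e})"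
  have fin: "finite V1" "finite V2" "finite V3" using G V by (auto simp: tensor_network_def)
  have two: "\<exists>v w. e = {v, w} \<and> v \<in> verts G \<and> w \<in> verts G" if "e \<in> edges G" for e
    using G that by (fastforce simp: tensor_network_def card_2_iff)
  have tri: "(x \<in> V1 \<and> x \<notin> V2 \<and> x \<notin> V3) \<or> (x \<notin> V1 \<and> x \<in> V2 \<and> x \<notin> V3)
      \<or> (x \<notin> V1 \<and> x \<notin> V2 \<and> x \<in> V3)" if "x \<in> verts G" for x
    using V that by blast
  have cases: "(e \<in> ?E1 \<and> e \<notin> ?Ca \<and> e \<notin> ?Cb \<and> e \<notin> ?Cc \<and> e \<notin> ?E2 \<and> e \<notin> ?E3) \<or>
      (e \<in> ?E2 \<and> e \<notin> ?Ca \<and> e \<notin> ?Cb \<and> e \<notin> ?Cc \<and> e \<notin> ?E1 \<and> e \<notin> ?E3) \<or>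
      (e \<in> ?E3 \<and> e \<notin> ?Ca \<and> e \<notin> ?Cb \<and> e \<notin> ?Cc \<and> e \<notin> ?E1 \<and> e \<notin> ?E2) \<or>
      (e \<in> ?Ca \<and> e \<notin> ?Cb \<and> e \<notin> ?Cc \<and> e \<notin> ?E1 \<and> e \<notin> ?E2 \<and> e \<notin> ?E3) \<or>
      (e \<in> ?Cb \<and> e \<notin> ?Ca \<and> e \<notin> ?Cc \<and> e \<notin> ?E1 \<and> e \<notin> ?E2 \<and> e \<notin> ?E3) \<or>
      (e \<in> ?Cc \<and> e \<notin> ?Ca \<and> e \<notin> ?Cb \<and> e \<notin> ?E1 \<and> e \<notin> ?E2 \<and> e \<notin> ?E3)"
    if e: "e \<in> edges G" for e
  proof -
    obtain v w where vw: "e = {v, w}" "v \<in> verts G" "w \<in> verts G"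
      using two[OF e] by blast
    from tri[OF vw(2)] tri[OF vw(3)] e show ?thesis unfolding vw(1)
      by (elim disjE) (simp_all add: cut_def inner_edges_def)
  qed
  have sub: "?Ca \<subseteq> edges G" "?Cb \<subseteq> edges G" "?Cc \<subseteq> edges G"
      "?E1 \<subseteq> edges G" "?E2 \<subseteq> edges G" "?E3 \<subseteq> edges G"
    by (auto simp: cut_def inner_edges_def)
  \<comment> \<open>Nested to the right, so that the bond sum splits off one edge set at a
    time.\<close>
  have E: "edges G = ?Ca \<union> (?Cb \<union> (?Cc \<union> (?E1 \<union> (?E2 \<union> ?E3))))"
    using cases sub by blast
  have dj: "?Ca \<inter> (?Cb \<union> (?Cc \<union> (?E1 \<union> (?E2 \<union> ?E3)))) = {}" "?Cb \<inter> (?Cc \<union> (?E1 \<union> (?E2 \<union> ?E3))) = {}"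
    "?Cc \<inter> (?E1 \<union> (?E2 \<union> ?E3)) = {}" "?E1 \<inter> (?E2 \<union> ?E3) = {}" "?E2 \<inter> ?E3 = {}"
    using cases sub by blast+
  let ?n = "\<lambda>\<alpha> \<beta> \<gamma> n1 n2 n3 e. if e \<in> ?Ca then \<alpha> e else if e \<in> ?Cb then \<beta> e else if e \<in> ?Cc then \<gamma> e
    else if e \<in> ?E1 then n1 e else if e \<in> ?E2 then n2 e else n3 e"
  let ?A = "\<lambda>n i. A i (\<sigma> i) (restrict n (incident G i))"
  \<comment> \<open>The sites of a block read only its inner bonds and the two cuts that touch it;
    this makes the product over all sites separate in \<open>split\<close>.\<close>
  have inc1: "e \<in> ?E1 \<or> e \<in> ?Ca \<or> e \<in> ?Cb" if "e \<in> incident G i" "i \<in> V1" for e i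
  proof -
    have e: "e \<in> edges G" "i \<in> e" using that by (auto simp: incident_def)
    with two[OF e(1)] obtain w where "e = {i, w}" "w \<in> V1 \<or> w \<in> V2 \<or> w \<in> V3" using V(1) by blast
    then show ?thesis using e that(2) by (auto simp: cut_def inner_edges_def)
  qed
  have inc2: "e \<in> ?E2 \<or> e \<in> ?Cb \<or> e \<in> ?Cc" if "e \<in> incident G i" "i \<in> V2" for e i
  proof -
    have e: "e \<in> edges G" "i \<in> e" using that by (auto simp: incident_def)
    with two[OF e(1)] obtain w where "e = {i, w}" "w \<in> V1 \<or> w \<in> V2 \<or> w \<in> V3" using V(1) by blast
    then show ?thesis using e that(2) by (auto simp: cut_def inner_edges_def)
  qed
  have inc3: "e \<in> ?E3 \<or> e \<in> ?Cc \<or> e \<in> ?Ca" if "e \<in> incident G i" "i \<in> V3" for e i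
  proof -
    have e: "e \<in> edges G" "i \<in> e" using that by (auto simp: incident_def)
    with two[OF e(1)] obtain w where "e = {i, w}" "w \<in> V1 \<or> w \<in> V2 \<or> w \<in> V3" using V(1) by blast
    then show ?thesis using e that(2) by (auto simp: cut_def inner_edges_def)
  qed
  have split: "(\<Prod>i\<in>verts G. ?A (?n \<alpha> \<beta> \<gamma> n1 n2 n3) i) =
     (\<Prod>i\<in>V1. ?A (\<lambda>e. if e \<in> ?E1 then n1 e else if e \<in> ?Ca then \<alpha> e else \<beta> e) i) *
     ((\<Prod>i\<in>V2. ?A (\<lambda>e. if e \<in> ?E2 then n2 e else if e \<in> ?Cb then \<beta> e else \<gamma> e) i) *
      (\<Prod>i\<in>V3. ?A (\<lambda>e. if e \<in> ?E3 then n3 e else if e \<in> ?Cc then \<gamma> e else \<alpha> e) i))"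
    for \<alpha> \<beta> \<gamma> n1 n2 n3
  proof -
    have "(\<Prod>i\<in>verts G. f i) = prod f V1 * (prod f V2 * prod f V3)" for f :: "'a \<Rightarrow> complex"
      using V fin by (simp add: prod.union_disjoint Int_Un_distrib Int_Un_distrib2 mult.assoc)
    moreover have "restrict (?n \<alpha> \<beta> \<gamma> n1 n2 n3) (incident G i)
        = restrict (\<lambda>e. if e \<in> ?E1 then n1 e else if e \<in> ?Ca then \<alpha> e else \<beta> e) (incident G i)"
      if "i \<in> V1" for i
      using inc1[OF _ that] dj by (intro restrict_ext) auto
    moreover have "restrict (?n \<alpha> \<beta> \<gamma> n1 n2 n3) (incident G i)
        = restrict (\<lambda>e. if e \<in> ?E2 then n2 e else if e \<in> ?Cb then \<beta> e else \<gamma> e) (incident G i)"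
      if "i \<in> V2" for i
      using inc2[OF _ that] dj by (intro restrict_ext) auto
    moreover have "restrict (?n \<alpha> \<beta> \<gamma> n1 n2 n3) (incident G i)
        = restrict (\<lambda>e. if e \<in> ?E3 then n3 e else if e \<in> ?Cc then \<gamma> e else \<alpha> e) (incident G i)"
      if "i \<in> V3" for i
      using inc3[OF _ that] dj by (intro restrict_ext) auto
    ultimately show ?thesis by simp
  qed
  have "contract G A \<sigma> = (\<Sum>n\<in>Pi\<^sub>E (edges G) F. \<Prod>i\<in>verts G. ?A n i)"
    using \<sigma> by (simp add: contract_def bond_configs_def F_def)
  also have "\<dots> = (\<Sum>\<alpha>\<in>Pi\<^sub>E ?Ca F. \<Sum>\<beta>\<in>Pi\<^sub>E ?Cb F. \<Sum>\<gamma>\<in>Pi\<^sub>E ?Cc F. \<Sum>n1\<in>Pi\<^sub>E ?E1 F.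
      \<Sum>n2\<in>Pi\<^sub>E ?E2 F. \<Sum>n3\<in>Pi\<^sub>E ?E3 F. \<Prod>i\<in>verts G. ?A (?n \<alpha> \<beta> \<gamma> n1 n2 n3) i)"
    by (subst E, simp only: sum_PiE_Un dj)
  also have "\<dots> = (\<Sum>\<alpha>\<in>Pi\<^sub>E ?Ca F. \<Sum>\<beta>\<in>Pi\<^sub>E ?Cb F. \<Sum>\<gamma>\<in>Pi\<^sub>E ?Cc F.
      (block_tensor G A V1 ?Ca \<sigma> \<alpha> \<beta> * (block_tensor G A V2 ?Cb \<sigma> \<beta> \<gamma> * block_tensor G A V3 ?Cc \<sigma> \<gamma> \<alpha>)))"
    unfolding split block_tensor_def edge_configs_def F_def[symmetric] sum_product
    by (intro sum.cong refl) (simp add: sum_distrib_left)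
  finally show ?thesis by (simp add: ring_sum_def edge_configs_def F_def mult.assoc)
qed

section \<open>Scaling and limits of contractions\<close>

text \<open>The factor is absorbed into the tensor of a single site.\<close>

lemma contract_smult:
  assumes "finite (verts G)" "verts G \<noteq> {}"
  shows "\<exists>A'. contract G A' = (\<lambda>\<sigma>. c * contract G A \<sigma>)"
proof -
  obtain i0 where i0: "i0 \<in> verts G" using assms by blast
  let ?A = "A(i0 := \<lambda>s n. c * A i0 s n)"
  have "(\<Prod>i\<in>verts G. ?A i (\<sigma> i) (n i)) = c * (\<Prod>i\<in>verts G. A i (\<sigma> i) (n i))" for \<sigma> n
    using assms i0 by (simp add: prod.remove[of _ i0] mult.assoc)
  then have "contract G ?A = (\<lambda>\<sigma>. c * contract G A \<sigma>)"
    by (auto simp: contract_def fun_eq_iff sum_distrib_left)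
  then show ?thesis by blast
qed

lemma state_norm_scale: "state_norm G (\<lambda>\<sigma>. c * \<Psi> \<sigma>) = cmod c * state_norm G \<Psi>"
  by (simp add: state_norm_def norm_mult L2_set_right_distrib[symmetric])

lemma tendsto_state_dist:
  assumes "\<And>\<sigma>. \<sigma> \<in> configs G \<Longrightarrow> (\<lambda>n. \<Psi> n \<sigma>) \<longlonglongrightarrow> \<Phi> \<sigma>"
  shows "(\<lambda>n. state_dist G (\<Psi> n) \<Phi>) \<longlonglongrightarrow> 0"
proof -
  have "(\<lambda>n. state_dist G (\<Psi> n) \<Phi>) \<longlonglongrightarrow> sqrt (\<Sum>\<sigma>\<in>configs G. (cmod (\<Phi> \<sigma> - \<Phi> \<sigma>))\<^sup>2)"
    unfolding state_dist_def state_norm_def L2_set_def by (intro tendsto_intros assms)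
  then show ?thesis by simp
qed

lemma tendsto_state_norm:
  assumes "\<And>\<sigma>. \<sigma> \<in> configs G \<Longrightarrow> (\<lambda>n. \<Psi> n \<sigma>) \<longlonglongrightarrow> \<Phi> \<sigma>"
  shows "(\<lambda>n. state_norm G (\<Psi> n)) \<longlonglongrightarrow> state_norm G \<Phi>"
  unfolding state_norm_def L2_set_def by (intro tendsto_intros assms)

text \<open>The limit is nonzero, so the norms converge to a positive number and the normalized
  vectors converge to the normalized limit. Closedness applies to these, and the limit is then
  scaled back.\<close>

lemma PEPS_closed_limit:
  assumes G: "tensor_network G" and closed: "closedin (norm_topology G) (PEPS G)"
    and \<Psi>: "\<And>n. \<exists>A. \<Psi> n = contract G A"
    and lim: "\<And>\<sigma>. \<sigma> \<in> configs G \<Longrightarrow> (\<lambda>n. \<Psi> n \<sigma>) \<longlonglongrightarrow> \<Phi> \<sigma>"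
    and \<Phi>: "\<Phi> \<in> state_space G" "\<Phi> \<noteq> (\<lambda>_. 0)"
  shows "\<exists>A. \<Phi> = contract G A"
proof -
  have fin: "finite (verts G)" "verts G \<noteq> {}"
    using G by (auto simp: tensor_network_def connected_graph_def)
  interpret Metric_space "state_space G" "state_dist G"
    using Metric_space_state_space[OF fin(1)] .
  have smult: "\<exists>A'. (\<lambda>\<sigma>. c * contract G A \<sigma>) = contract G A'" for c A
    using contract_smult[OF fin, of c A] by metis
  have "state_norm G \<Phi> \<noteq> 0"
    using \<Phi> finite_configs[OF fin(1)]
    by (auto simp: state_norm_def L2_set_eq_0_iff state_space_def fun_eq_iff)
  then have pos: "state_norm G \<Phi> > 0" by (simp add: state_norm_def order_less_le)
  have norms: "(\<lambda>n. state_norm G (\<Psi> n)) \<longlonglongrightarrow> state_norm G \<Phi>"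
    using lim by (rule tendsto_state_norm)
  define c :: "(('a \<Rightarrow> nat) \<Rightarrow> complex) \<Rightarrow> complex"
    where "c X = of_real (1 / state_norm G X)" for X
  let ?\<Psi> = "\<lambda>n \<sigma>. c (\<Psi> n) * \<Psi> n \<sigma>" and ?\<Phi> = "\<lambda>\<sigma>. c \<Phi> * \<Phi> \<sigma>"
  have "(\<lambda>n. ?\<Psi> n \<sigma>) \<longlonglongrightarrow> ?\<Phi> \<sigma>" if "\<sigma> \<in> configs G" for \<sigma>
    unfolding c_def using pos by (intro tendsto_intros norms lim that) auto
  then have lim': "(\<lambda>n. state_dist G (?\<Psi> n) ?\<Phi>) \<longlonglongrightarrow> 0" by (rule tendsto_state_dist)
  \<comment> \<open>For a vector of norm 0 the factor \<open>c\<close> is 0, so membership in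
    \<open>PEPS G\<close> is claimed only eventually.\<close>
  have "eventually (\<lambda>n. state_norm G (\<Psi> n) > 0) sequentially"
    using order_tendstoD(1)[OF norms pos] .
  then have ev: "eventually (\<lambda>n. ?\<Psi> n \<in> PEPS G) sequentially"
  proof eventually_elim
    case (elim n)
    have "\<exists>A. ?\<Psi> n = contract G A" using \<Psi>[of n] smult by metis
    moreover have "state_norm G (?\<Psi> n) = 1"
      unfolding state_norm_scale using elim by (simp add: c_def norm_divide)
    ultimately show ?case by (simp add: PEPS_def)
  qed
  have "limitin mtopology ?\<Psi> ?\<Phi> sequentially"
    unfolding limit_metric_sequentially
  proof (intro conjI allI impI)
    show "?\<Phi> \<in> state_space G" using \<Phi> by (simp add: state_space_def)
    fix \<epsilon> :: real assume "\<epsilon> > 0"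
    then have "eventually (\<lambda>n. state_dist G (?\<Psi> n) ?\<Phi> < \<epsilon>) sequentially"
      using lim' by (rule order_tendstoD(2)[rotated])
    with ev have "eventually (\<lambda>n. ?\<Psi> n \<in> state_space G \<and> state_dist G (?\<Psi> n) ?\<Phi> < \<epsilon>) sequentially"
      by eventually_elim (use PEPS_subset_state_space in blast)
    then show "\<exists>N. \<forall>n\<ge>N. ?\<Psi> n \<in> state_space G \<and> state_dist G (?\<Psi> n) ?\<Phi> < \<epsilon>"
      by (simp add: eventually_sequentially)
  qed
  then have "?\<Phi> \<in> PEPS G"
    using closed ev unfolding norm_topology_def by (rule limitin_closedin) simp
  then obtain A where A: "?\<Phi> = contract G A" by (auto simp: PEPS_def)
  obtain A' where A': "(\<lambda>\<sigma>. inverse (c \<Phi>) * contract G A \<sigma>) = contract G A'"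
    using smult by blast
  have "\<Phi> = (\<lambda>\<sigma>. inverse (c \<Phi>) * contract G A \<sigma>)"
    unfolding A[symmetric] using pos by (simp add: c_def)
  from trans[OF this A'] show ?thesis by (rule exI[where x = A'])
qed


section \<open>Geometry of a periodic lattice\<close>

locale ring_lattice =
  fixes D d lx Nc :: nat
    and L :: "nat \<Rightarrow> nat" and per :: "nat \<Rightarrow> bool"
    and G :: "(nat \<Rightarrow> nat) network"
  assumes D: "D \<ge> 1" and d: "d \<ge> 2" and lx: "lx \<ge> 1" and Nc: "Nc \<ge> 3"
    and network: "tensor_network G"
    and verts: "verts G = lattice_verts D L"
    and edges: "edges G = lattice_edges D L per"
    and site_dim: "i \<in> verts G \<Longrightarrow> site_dim G i \<ge> d"
    and per: "per 0"
    and L0: "L 0 = 2 * Nc * lx"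
    and bond_dim_x: "e \<in> lattice_edges_dir D L per 0 \<Longrightarrow> bond_dim G e = d ^ lx"
    and L_pos: "k \<in> {1..<D} \<Longrightarrow> L k \<ge> 1"
begin

lemma L0_ge: "6 * lx \<le> L 0"
  using Nc by (simp add: L0)

lemma L0_pos: "3 \<le> L 0"
  using L0_ge lx by linarith

lemma finite_verts: "finite (verts G)"
  using network by (simp add: tensor_network_def)

lemma finite_edges: "finite (edges G)"
  using network by (auto simp: tensor_network_def intro: rev_finite_subset[of "Pow (verts G)"])

lemma verts_coord0: "v \<in> verts G \<Longrightarrow> 1 \<le> v 0 \<and> v 0 \<le> L 0"
  using D by (auto simp: verts lattice_verts_def PiE_iff)

lemma verts_upd: "v \<in> verts G \<Longrightarrow> 1 \<le> x \<Longrightarrow> x \<le> L 0 \<Longrightarrow> v(0 := x) \<in> verts G"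
  using D by (auto simp: verts lattice_verts_def PiE_iff extensional_def)

section \<open>Cyclic shifts and edges in the \<open>x\<close> direction\<close>

text \<open>Coordinates start at 1, so a shift that lands on 0 has to wrap to \<open>L 0\<close>;
  hence the strict \<open>j < v 0\<close>.\<close>

definition behind :: "nat \<Rightarrow> (nat \<Rightarrow> nat) \<Rightarrow> (nat \<Rightarrow> nat)" where
  "behind j v = v(0 := if j < v 0 then v 0 - j else v 0 + L 0 - j)"

definition ahead :: "(nat \<Rightarrow> nat) \<Rightarrow> (nat \<Rightarrow> nat)" where
  "ahead v = v(0 := if v 0 = L 0 then 1 else v 0 + 1)"

definition fwd :: "(nat \<Rightarrow> nat) \<Rightarrow> (nat \<Rightarrow> nat) set" where
  "fwd v = {v, ahead v}"

lemma behind_in: "v \<in> verts G \<Longrightarrow> j < L 0 \<Longrightarrow> behind j v \<in> verts G"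
  unfolding behind_def using verts_coord0[of v] by (intro verts_upd) auto

lemma ahead_in: "v \<in> verts G \<Longrightarrow> ahead v \<in> verts G"
  unfolding ahead_def using verts_coord0[of v] by (intro verts_upd) auto

lemma behind_0 [simp]: "v \<in> verts G \<Longrightarrow> behind 0 v = v"
  using verts_coord0[of v] by (auto simp: behind_def)

lemma behind_behind: "v \<in> verts G \<Longrightarrow> j + k < L 0 \<Longrightarrow> behind j (behind k v) = behind (j + k) v"
  using verts_coord0[of v] by (auto simp: behind_def fun_eq_iff)

lemma ahead_behind: "v \<in> verts G \<Longrightarrow> ahead (behind 1 v) = v"
  using verts_coord0[of v] L0_pos by (auto simp: behind_def ahead_def fun_eq_iff)

lemma behind_ahead: "v \<in> verts G \<Longrightarrow> behind 1 (ahead v) = v"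
  using verts_coord0[of v] L0_pos by (auto simp: behind_def ahead_def fun_eq_iff)

lemma fwd_edge_x: "v \<in> verts G \<Longrightarrow> fwd v \<in> lattice_edges_dir D L per 0"
  using ahead_in[of v] verts_coord0[of v] L0_pos per
  unfolding lattice_edges_dir_def fwd_def verts
  by (intro CollectI exI[of _ v] exI[of _ "ahead v"]) (auto simp: ahead_def)

lemma fwd_edge: "v \<in> verts G \<Longrightarrow> fwd v \<in> edges G"
  using fwd_edge_x[of v] D by (auto simp: edges lattice_edges_def intro!: bexI[of _ 0])

lemma edge_x_fwd:
  assumes "e \<in> lattice_edges_dir D L per 0"
  shows "e \<in> fwd ` verts G"
proof -
  obtain v w where vw: "e = {v, w}" "v \<in> verts G" "w \<in> verts G" "\<forall>j<D. j \<noteq> 0 \<longrightarrow> v j = w j"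
    "w 0 = v 0 + 1 \<or> v 0 = L 0 \<and> w 0 = 1"
    using assms by (auto simp: lattice_edges_dir_def verts)
  have "w k = ahead v k" for k
  proof (cases "k < D")
    case True
    with vw verts_coord0[of w] show ?thesis by (cases "k = 0") (auto simp: ahead_def)
  next
    case False
    with vw D show ?thesis
      by (auto simp: ahead_def verts lattice_verts_def PiE_iff extensional_def)
  qed
  then have "e = fwd v" using vw by (auto simp: fwd_def fun_eq_iff)
  with vw show ?thesis by blast
qed

text \<open>Separates the edges that advance in the \<open>x\<close> direction from those that stay
  within a layer; only the former can cross between blocks of layers.\<close>

lemma edge_cases:
  assumes "e \<in> edges G"
  obtains v where "v \<in> verts G" "e = fwd v" | v w where "e = {v, w}" "v 0 = w 0"
proof -
  obtain k where k: "k < D" "e \<in> lattice_edges_dir D L per k"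
    using assms by (auto simp: edges lattice_edges_def)
  show ?thesis
  proof (cases "k = 0")
    case True
    then show ?thesis using edge_x_fwd k that by blast
  next
    case False
    obtain v w where "e = {v, w}" "\<forall>j<D. j \<noteq> k \<longrightarrow> v j = w j"
      using k(2) unfolding lattice_edges_dir_def by blast
    moreover from this have "v 0 = w 0" using False D by simp
    ultimately show ?thesis using that(2) by blast
  qed
qed

text \<open>Two sites with a common forward edge would each be ahead of the other, which a ring of
  length at least 3 excludes.\<close>

lemma fwd_inj: "inj_on fwd (verts G)"
proof (rule inj_onI)
  fix v w assume vw: "v \<in> verts G" "w \<in> verts G" "fwd v = fwd w"
  show "v = w"
  proof (rule ccontr)
    assume "v \<noteq> w"
    then have "v = ahead w \<and> ahead v = w"
      using vw(3) unfolding fwd_def doubleton_eq_iff by blast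
    then have "v 0 = ahead w 0" "w 0 = ahead v 0" by (metis, metis)
    then have "v 0 = w 0 + 1 \<or> w 0 = L 0 \<and> v 0 = 1" "w 0 = v 0 + 1 \<or> v 0 = L 0 \<and> w 0 = 1"
      unfolding ahead_def fun_upd_same by meson+
    then show False using L0_pos by linarith
  qed
qed

lemma fwd_incident: "v \<in> verts G \<Longrightarrow> fwd v \<in> incident G v"
  using fwd_edge by (auto simp: incident_def fwd_def)

lemma fwd_behind_incident: "v \<in> verts G \<Longrightarrow> fwd (behind 1 v) \<in> incident G v"
  using fwd_edge[OF behind_in[of v 1]] ahead_behind[of v] L0_pos by (auto simp: incident_def fwd_def)


subsection \<open>Shift registers\<close>

definition digit_strings :: "(nat \<Rightarrow> nat) set" where
  "digit_strings = (\<Pi>\<^sub>E j\<in>{..<lx}. {1..d})"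

text \<open>Reads a bond index as a string of \<open>lx\<close> physical indices. Any bijection
  serves, and equal cardinality provides one.\<close>

definition digits :: "nat \<Rightarrow> nat \<Rightarrow> nat" where
  "digits = (SOME f. bij_betw f {1..d ^ lx} digit_strings)"

lemma digits_bij: "bij_betw digits {1..d ^ lx} digit_strings"
proof -
  have "card digit_strings = card {1..d ^ lx}" "finite digit_strings"
    by (simp_all add: digit_strings_def card_PiE finite_PiE)
  then have "\<exists>f. bij_betw f {1..d ^ lx} digit_strings"
    by (intro finite_same_card_bij) auto
  then show ?thesis unfolding digits_def by (rule someI_ex)
qed

text \<open>A shift register: the bond from a site to the next one carries the last
  \<open>lx\<close> physical indices, so the
  weight \<open>h\<close> at a site may depend on the physical index \<open>lx\<close> sites further back.\<close>

definition register_tensor ::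
    "((nat \<Rightarrow> nat) \<Rightarrow> nat \<Rightarrow> nat \<Rightarrow> complex) \<Rightarrow> (nat \<Rightarrow> nat) \<Rightarrow> nat \<Rightarrow> ((nat \<Rightarrow> nat) set \<Rightarrow> nat) \<Rightarrow> complex"
  where
  "register_tensor h v s n =
    (if s \<le> d \<and> (\<forall>e\<in>incident G v - {fwd v, fwd (behind 1 v)}. n e = 1) \<and>
        digits (n (fwd v)) = (\<lambda>j\<in>{..<lx}. if j = 0 then s else digits (n (fwd (behind 1 v))) (j - 1))
     then h v (digits (n (fwd (behind 1 v))) (lx - 1)) s else 0)"

text \<open>The only bond configuration that can contribute to the amplitude of \<sigma>: forward
  bonds record the last \<open>lx\<close> physical indices, newest first, and all other bonds are
  frozen at 1.\<close>

definition register_bonds :: "((nat \<Rightarrow> nat) \<Rightarrow> nat) \<Rightarrow> (nat \<Rightarrow> nat) set \<Rightarrow> nat" where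
  "register_bonds \<sigma> = (\<lambda>e\<in>edges G. if e \<in> fwd ` verts G
     then inv_into {1..d ^ lx} digits (\<lambda>j\<in>{..<lx}. \<sigma> (behind j (inv_into (verts G) fwd e))) else 1)"

lemma register_window:
  assumes \<sigma>: "\<sigma> \<in> configs G" "\<forall>v\<in>verts G. \<sigma> v \<le> d" and v: "v \<in> verts G"
  shows "(\<lambda>j\<in>{..<lx}. \<sigma> (behind j v)) \<in> digit_strings"
proof -
  have "\<sigma> (behind j v) \<in> {1..d}" if "j < lx" for j
  proof -
    have "behind j v \<in> verts G" using behind_in[OF v, of j] that L0_ge by linarith
    then show ?thesis using \<sigma> by (auto simp: configs_def PiE_iff)
  qed
  then show ?thesis by (auto simp: digit_strings_def)
qed

lemma register_bonds_fwd:
  assumes \<sigma>: "\<sigma> \<in> configs G" "\<forall>v\<in>verts G. \<sigma> v \<le> d" and v: "v \<in> verts G"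
  shows "digits (register_bonds \<sigma> (fwd v)) = (\<lambda>j\<in>{..<lx}. \<sigma> (behind j v))"
    and "register_bonds \<sigma> (fwd v) \<in> {1..d ^ lx}"
proof -
  have rb: "register_bonds \<sigma> (fwd v) = inv_into {1..d ^ lx} digits (\<lambda>j\<in>{..<lx}. \<sigma> (behind j v))"
    using v fwd_edge by (simp add: register_bonds_def inv_into_f_f[OF fwd_inj])
  have im: "(\<lambda>j\<in>{..<lx}. \<sigma> (behind j v)) \<in> digits ` {1..d ^ lx}"
    using register_window[OF assms] digits_bij by (simp add: bij_betw_def)
  show "digits (register_bonds \<sigma> (fwd v)) = (\<lambda>j\<in>{..<lx}. \<sigma> (behind j v))"
    unfolding rb using im by (rule f_inv_into_f)
  show "register_bonds \<sigma> (fwd v) \<in> {1..d ^ lx}"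
    unfolding rb using im by (rule inv_into_into)
qed

lemma register_bonds_in:
  assumes \<sigma>: "\<sigma> \<in> configs G" "\<forall>v\<in>verts G. \<sigma> v \<le> d"
  shows "register_bonds \<sigma> \<in> bond_configs G"
proof -
  have "register_bonds \<sigma> e \<in> {1..bond_dim G e}" if e: "e \<in> edges G" for e
  proof (cases "e \<in> fwd ` verts G")
    case True
    then obtain v where v: "v \<in> verts G" "e = fwd v" by blast
    then show ?thesis
      using register_bonds_fwd(2)[OF \<sigma> v(1)] bond_dim_x[OF fwd_edge_x[OF v(1)]] by simp
  next
    case False
    have "bond_dim G e \<ge> 1" using network e by (auto simp: tensor_network_def)
    then show ?thesis using e False by (simp add: register_bonds_def)
  qed
  then show ?thesis by (auto simp: bond_configs_def PiE_iff register_bonds_def)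
qed

lemma register_tensor_at_bonds:
  assumes \<sigma>: "\<sigma> \<in> configs G" "\<forall>v\<in>verts G. \<sigma> v \<le> d" and v: "v \<in> verts G"
  shows "register_tensor h v (\<sigma> v) (restrict (register_bonds \<sigma>) (incident G v))
    = h v (\<sigma> (behind lx v)) (\<sigma> v)"
proof -
  let ?n = "restrict (register_bonds \<sigma>) (incident G v)"
  have u: "behind 1 v \<in> verts G" using v L0_pos by (intro behind_in) auto
  have step: "behind j (behind 1 v) = behind (Suc j) v" if "j < lx" for j
    using behind_behind[OF v, of j 1] that L0_ge lx by simp
  have n1: "digits (?n (fwd v)) = (\<lambda>j\<in>{..<lx}. \<sigma> (behind j v))"
    using register_bonds_fwd(1)[OF \<sigma> v] fwd_incident[OF v] by simp
  have n2: "digits (?n (fwd (behind 1 v))) = (\<lambda>j\<in>{..<lx}. \<sigma> (behind (Suc j) v))"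
    using register_bonds_fwd(1)[OF \<sigma> u] fwd_behind_incident[OF v]
    by (auto simp: step[unfolded One_nat_def] intro!: restrict_ext)
  have other: "?n e = 1" if "e \<in> incident G v - {fwd v, fwd (behind 1 v)}" for e
  proof -
    have "e \<notin> fwd ` verts G"
    proof
      assume "e \<in> fwd ` verts G"
      then obtain w where w: "w \<in> verts G" "e = fwd w" by blast
      then have "v = w \<or> v = ahead w" using that by (auto simp: incident_def fwd_def)
      then show False using w that behind_ahead[of w] by auto
    qed
    then show ?thesis using that by (auto simp: register_bonds_def incident_def)
  qed
  have "(\<lambda>j\<in>{..<lx}. \<sigma> (behind j v))
      = (\<lambda>j\<in>{..<lx}. if j = 0 then \<sigma> v else digits (?n (fwd (behind 1 v))) (j - 1))"
    unfolding n2 using v by (intro restrict_ext) auto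
  \<comment> \<open>The incoming bond starts one site back, so its digit \<open>lx - 1\<close> comes
    from \<open>lx\<close> sites back.\<close>
  moreover have "digits (?n (fwd (behind 1 v))) (lx - 1) = \<sigma> (behind lx v)"
    unfolding n2 using lx by simp
  ultimately show ?thesis
    unfolding register_tensor_def n1 using other \<sigma> v by auto
qed

text \<open>A nonzero factor forces digit 0 of a forward bond to be the physical index, and each
  later digit to be the preceding digit one bond back. Following a digit back determines it.\<close>

lemma register_bonds_unique:
  assumes \<sigma>: "\<sigma> \<in> configs G" "\<forall>v\<in>verts G. \<sigma> v \<le> d" and n: "n \<in> bond_configs G"
    and nz: "\<And>v. v \<in> verts G \<Longrightarrow> register_tensor h v (\<sigma> v) (restrict n (incident G v)) \<noteq> 0"
  shows "n = register_bonds \<sigma>"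
proof -
  have shift: "digits (n (fwd v)) j = (if j = 0 then \<sigma> v else digits (n (fwd (behind 1 v))) (j - 1))"
    if "v \<in> verts G" "j < lx" for v j
  proof -
    have "digits (n (fwd v)) = (\<lambda>j\<in>{..<lx}. if j = 0 then \<sigma> v else digits (n (fwd (behind 1 v))) (j - 1))"
      using nz[OF that(1)] fwd_incident[OF that(1)] fwd_behind_incident[OF that(1)]
      by (auto simp: register_tensor_def split: if_splits)
    with that show ?thesis by simp
  qed
  have win: "j < lx \<Longrightarrow> v \<in> verts G \<Longrightarrow> digits (n (fwd v)) j = \<sigma> (behind j v)" for j v
  proof (induction j arbitrary: v)
    case 0
    then show ?case using shift[of v 0] by simp
  next
    case (Suc j)
    have "behind 1 v \<in> verts G" using Suc.prems L0_pos by (intro behind_in) auto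
    moreover have "behind j (behind 1 v) = behind (Suc j) v"
      using behind_behind[of v j 1] Suc.prems L0_ge by simp
    ultimately show ?case using shift[of v "Suc j"] Suc by simp
  qed
  have in_range: "n (fwd v) \<in> {1..d ^ lx}" if "v \<in> verts G" for v
    using n fwd_edge[OF that] bond_dim_x[OF fwd_edge_x[OF that]]
    by (auto simp: bond_configs_def PiE_iff)
  have "n e = register_bonds \<sigma> e" if e: "e \<in> edges G" for e
  proof (cases "e \<in> fwd ` verts G")
    case True
    then obtain v where v: "v \<in> verts G" "e = fwd v" by blast
    have "digits (n (fwd v)) \<in> digit_strings"
      using digits_bij in_range[OF v(1)] by (auto simp: bij_betw_def)
    then have "digits (n (fwd v)) = (\<lambda>j\<in>{..<lx}. \<sigma> (behind j v))"
      using win[OF _ v(1)] by (auto simp: digit_strings_def PiE_iff extensional_def fun_eq_iff)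
    then have "digits (n (fwd v)) = digits (register_bonds \<sigma> (fwd v))"
      using register_bonds_fwd(1)[OF \<sigma> v(1)] by simp
    then have "n (fwd v) = register_bonds \<sigma> (fwd v)"
      using digits_bij in_range[OF v(1)] register_bonds_fwd(2)[OF \<sigma> v(1)]
      by (auto simp: bij_betw_def dest: inj_onD)
    then show ?thesis by (simp add: v)
  next
    case False
    have "card e = 2" "e \<subseteq> verts G" using network e by (auto simp: tensor_network_def)
    then obtain v where v: "v \<in> e" "v \<in> verts G" by (auto simp: card_2_iff)
    then have "e \<in> incident G v" using e by (simp add: incident_def)
    moreover have "e \<noteq> fwd v" "e \<noteq> fwd (behind 1 v)"
      using False v behind_in[of v 1] L0_pos by auto
    moreover have "\<forall>e\<in>incident G v - {fwd v, fwd (behind 1 v)}. restrict n (incident G v) e = 1"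
      using nz[OF v(2)] unfolding register_tensor_def by (metis (no_types, lifting))
    ultimately have "n e = 1" by auto
    then show ?thesis using False e by (simp add: register_bonds_def)
  qed
  then show ?thesis using n
    by (auto simp: fun_eq_iff bond_configs_def PiE_iff extensional_def register_bonds_def)
qed

text \<open>The bond sum collapses to its single possible term. Physical indices above
  \<open>d\<close>, which a site may have, get amplitude 0.\<close>

lemma contract_register:
  assumes \<sigma>: "\<sigma> \<in> configs G"
  shows "contract G (register_tensor h) \<sigma>
    = (if \<forall>v\<in>verts G. \<sigma> v \<le> d then \<Prod>v\<in>verts G. h v (\<sigma> (behind lx v)) (\<sigma> v) else 0)"
proof (cases "\<forall>v\<in>verts G. \<sigma> v \<le> d")
  case False
  then obtain v where v: "v \<in> verts G" "\<not> \<sigma> v \<le> d" by blast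
  have "(\<Prod>i\<in>verts G. register_tensor h i (\<sigma> i) (restrict n (incident G i))) = 0" for n
  proof (rule prod_zero[OF finite_verts])
    have "register_tensor h v (\<sigma> v) n' = 0" for n'
      using v(2) by (simp add: register_tensor_def)
    then show "\<exists>i\<in>verts G. register_tensor h i (\<sigma> i) (restrict n (incident G i)) = 0"
      using v(1) by blast
  qed
  then have "contract G (register_tensor h) \<sigma> = 0" by (simp add: contract_def)
  then show ?thesis unfolding if_not_P[OF False] .
next
  case True
  let ?f = "\<lambda>n. \<Prod>i\<in>verts G. register_tensor h i (\<sigma> i) (restrict n (incident G i))"
  have "?f n = 0" if "n \<in> bond_configs G - {register_bonds \<sigma>}" for n
  proof (rule ccontr)
    assume "?f n \<noteq> 0"
    then have "register_tensor h v (\<sigma> v) (restrict n (incident G v)) \<noteq> 0" if "v \<in> verts G" for v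
      using that prod_zero_iff[OF finite_verts] by blast
    with that have "n = register_bonds \<sigma>"
      by (intro register_bonds_unique[OF \<sigma> True, of n h]) auto
    with that show False by simp
  qed
  moreover have "finite (bond_configs G)"
    using finite_edges by (simp add: bond_configs_def finite_PiE)
  ultimately have "contract G (register_tensor h) \<sigma> = ?f (register_bonds \<sigma>)"
    unfolding contract_def if_P[OF \<sigma>] using register_bonds_in[OF \<sigma> True] by (simp add: sum.remove)
  also have "\<dots> = (\<Prod>v\<in>verts G. h v (\<sigma> (behind lx v)) (\<sigma> v))"
    by (intro prod.cong refl register_tensor_at_bonds \<sigma> True)
  finally show ?thesis unfolding if_P[OF True] .
qed


subsection \<open>The degenerating family\<close>

text \<open>A site is encoded by its segment, numbered from 0 to \<open>2 * Nc - 1\<close>, and its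
  \<open>offset\<close>, the corresponding site of the first segment; \<open>shifted\<close> decodes
  the pair.\<close>

definition segment :: "(nat \<Rightarrow> nat) \<Rightarrow> nat" where
  "segment v = (v 0 - 1) div lx"

definition offset :: "(nat \<Rightarrow> nat) \<Rightarrow> (nat \<Rightarrow> nat)" where
  "offset v = v(0 := (v 0 - 1) mod lx + 1)"

definition shifted :: "nat \<Rightarrow> (nat \<Rightarrow> nat) \<Rightarrow> (nat \<Rightarrow> nat)" where
  "shifted q z = z(0 := z 0 + q * lx)"

definition first_segment :: "(nat \<Rightarrow> nat) set" where
  "first_segment = {v \<in> verts G. v 0 \<le> lx}"

definition prev_segment :: "nat \<Rightarrow> nat" where
  "prev_segment q = (if q = 0 then 2 * Nc - 1 else q - 1)"

definition corner :: "nat \<Rightarrow> nat" where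
  "corner = (\<lambda>k\<in>{..<D}. 1)"

lemma corner_in: "corner \<in> first_segment"
proof -
  have "1 \<le> L k" if "k < D" for k
    using L_pos[of k] that L0_pos by (cases "k = 0") auto
  then show ?thesis
    using D lx by (auto simp: first_segment_def verts lattice_verts_def corner_def)
qed

lemma segment_less:
  assumes "v \<in> verts G"
  shows "segment v < 2 * Nc"
proof -
  have "v 0 - 1 < 2 * Nc * lx" using verts_coord0[OF assms] unfolding L0 by linarith
  then show ?thesis unfolding segment_def using lx by (simp add: less_mult_imp_div_less)
qed

lemma offset_in:
  assumes "v \<in> verts G"
  shows "offset v \<in> first_segment"
proof -
  have "(v 0 - 1) mod lx < lx" using lx by simp
  then have "(v 0 - 1) mod lx + 1 \<le> lx" by linarith
  moreover have "lx \<le> L 0" using L0_ge by linarith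
  ultimately show ?thesis
    unfolding first_segment_def offset_def using verts_upd[OF assms] by auto
qed

lemma shifted:
  assumes z: "z \<in> first_segment" and q: "q < 2 * Nc"
  shows "shifted q z \<in> verts G" "segment (shifted q z) = q" "offset (shifted q z) = z"
proof -
  have z': "z \<in> verts G" "1 \<le> z 0" "z 0 \<le> lx"
    using z verts_coord0[of z] by (auto simp: first_segment_def)
  have "(q + 1) * lx \<le> 2 * Nc * lx" using q by (intro mult_right_mono) auto
  then have "z 0 + q * lx \<le> L 0" using z' by (simp add: L0)
  then show "shifted q z \<in> verts G"
    unfolding shifted_def using z' by (intro verts_upd) auto
  have eq: "z 0 + q * lx - 1 = (z 0 - 1) + q * lx" and less: "z 0 - 1 < lx" using z' by auto
  show "segment (shifted q z) = q"
  proof -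
    have "(z 0 + q * lx - 1) div lx = q"
      unfolding eq using less lx by (simp only: div_mult_self1 div_less)
    then show ?thesis by (simp add: segment_def shifted_def)
  qed
  show "offset (shifted q z) = z"
  proof -
    have "(z 0 + q * lx - 1) mod lx + 1 = z 0"
      unfolding eq mod_mult_self1 mod_less[OF less] using z' by simp
    then show ?thesis by (simp add: offset_def shifted_def fun_upd_idem)
  qed
qed

text \<open>Going back \<open>lx\<close> layers changes the segment cyclically and keeps the offset,
  so a register of length \<open>lx\<close> can copy whole segments.\<close>

lemma behind_lx:
  assumes v: "v \<in> verts G"
  shows "segment (behind lx v) = prev_segment (segment v)" "offset (behind lx v) = offset v"
proof -
  define x where "x = v 0 - 1"
  have v0: "v 0 = x + 1" "x < L 0" using verts_coord0[OF v] by (auto simp: x_def)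
  \<comment> \<open>Both cases differ from \<open>x\<close> by a multiple of \<open>lx\<close>, so
    quotient and remainder can be read off.\<close>
  have x': "behind lx v 0 - 1 = (if lx \<le> x then x - lx else x + (2 * Nc - 1) * lx)"
  proof (cases "lx \<le> x")
    case False
    have "L 0 = lx + (2 * Nc - 1) * lx" using Nc by (simp add: L0 algebra_simps)
    then show ?thesis using False v0 by (auto simp: behind_def)
  qed (use v0 in \<open>auto simp: behind_def\<close>)
  have dm: "((behind lx v 0 - 1) div lx = prev_segment (x div lx)) \<and> (behind lx v 0 - 1) mod lx = x mod lx"
  proof (cases "lx \<le> x")
    case True
    moreover from True lx have "x div lx \<noteq> 0" by (simp add: div_eq_0_iff)
    ultimately show ?thesis
      using lx unfolding x' by (simp add: prev_segment_def le_div_geq le_mod_geq)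
  next
    case False
    then show ?thesis using lx unfolding x' by (simp add: prev_segment_def)
  qed
  show "segment (behind lx v) = prev_segment (segment v)"
    using dm by (simp add: segment_def x_def)
  show "offset (behind lx v) = offset v"
    using dm by (auto simp: offset_def x_def behind_def)
qed

lemma shifted_behind:
  assumes "z \<in> first_segment" "q < 2 * Nc"
  shows "behind lx (shifted q z) = shifted (prev_segment q) z"
proof -
  have "shifted (segment v) (offset v) = v" if "v \<in> verts G" for v
    using verts_coord0[OF that] lx by (auto simp: shifted_def segment_def offset_def fun_eq_iff)
  moreover have "behind lx (shifted q z) \<in> verts G"
    using shifted(1)[OF assms] L0_ge lx by (intro behind_in) auto
  ultimately show ?thesis using behind_lx[OF shifted(1)[OF assms]] shifted(2,3)[OF assms] by metis
qed


text \<open>The ring of segments consists of three entangled pairs \<open>(1, 2)\<close>, \<open>(3, 4)\<close> and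
  \<open>(5, 6, \<dots>, 0)\<close>: a segment other than 1, 3, 5 is a copy of the previous one. At the corner
  sites of the segments 1, 3, 5, the weight \<open>t\<close> penalizes equality with the previous colour,
  where the colour of a segment tells whether its corner index is 1.\<close>

definition weight :: "complex \<Rightarrow> (nat \<Rightarrow> nat) \<Rightarrow> nat \<Rightarrow> nat \<Rightarrow> complex" where
  "weight t v old s =
    (if segment v \<in> {1, 3, 5} then
       if v \<in> (\<lambda>q. shifted q corner) ` {1, 3, 5} \<and> (s = 1 \<longleftrightarrow> old = 1) then t else 1
     else if s = old then 1 else 0)"

definition entangled :: "((nat \<Rightarrow> nat) \<Rightarrow> nat) \<Rightarrow> bool" where
  "entangled \<sigma> \<longleftrightarrow> (\<forall>v\<in>verts G. \<sigma> v \<le> d) \<and>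
    (\<forall>v\<in>verts G. segment v \<notin> {1, 3, 5} \<longrightarrow> \<sigma> v = \<sigma> (behind lx v))"

definition colour :: "((nat \<Rightarrow> nat) \<Rightarrow> nat) \<Rightarrow> nat \<Rightarrow> bool" where
  "colour \<sigma> q \<longleftrightarrow> \<sigma> (shifted q corner) = 1"

text \<open>The weighted contraction already divided by \<open>t\<close>, which also makes sense at
  \<open>t = 0\<close>, where it is the limit state.\<close>

definition approx_state :: "complex \<Rightarrow> ((nat \<Rightarrow> nat) \<Rightarrow> nat) \<Rightarrow> complex" where
  "approx_state t \<sigma> =
    (if \<sigma> \<in> configs G \<and> entangled \<sigma> then
       if colour \<sigma> 0 = colour \<sigma> 2 \<and> colour \<sigma> 2 = colour \<sigma> 4 then t\<^sup>2 else 1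
     else 0)"

lemma colour_copy:
  assumes "entangled \<sigma>" "q < 2 * Nc" "q \<notin> {1, 3, 5}"
  shows "colour \<sigma> q = colour \<sigma> (prev_segment q)"
proof -
  have "\<sigma> (shifted q corner) = \<sigma> (behind lx (shifted q corner))"
    using assms shifted(1,2)[OF corner_in assms(2)] unfolding entangled_def by metis
  then show ?thesis using shifted_behind[OF corner_in assms(2)] by (simp add: colour_def)
qed

text \<open>The segments after 5, up to the last one and around to 0, form a chain of
  copies.\<close>

lemma colour_wrap:
  assumes "entangled \<sigma>"
  shows "colour \<sigma> 0 = colour \<sigma> 5"
proof -
  have "q < 2 * Nc \<Longrightarrow> colour \<sigma> q = colour \<sigma> 5" if "5 \<le> q" for q
    using that
  proof (induction q rule: dec_induct)
    case (step q)
    then show ?case using colour_copy[OF assms, of "Suc q"] by (simp add: prev_segment_def)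
  qed simp
  from this[of "2 * Nc - 1"] show ?thesis
    using colour_copy[OF assms, of 0] Nc by (simp add: prev_segment_def)
qed

lemma prod_weight:
  assumes "\<sigma> \<in> configs G" "entangled \<sigma>"
  shows "(\<Prod>v\<in>verts G. weight t v (\<sigma> (behind lx v)) (\<sigma> v)) = t * approx_state t \<sigma>"
proof -
  let ?w = "\<lambda>v. weight t v (\<sigma> (behind lx v)) (\<sigma> v)" and ?C = "(\<lambda>q. shifted q corner) ` {1, 3, 5}"
  have q: "q < 2 * Nc" if "q \<in> {1, 3, 5}" for q using that Nc by auto
  have C: "?C \<subseteq> verts G" using shifted(1)[OF corner_in] q by auto
  have one: "?w v = 1" if "v \<in> verts G - ?C" for v
    using that assms(2) by (auto simp: weight_def entangled_def)
  have inj: "inj_on (\<lambda>q. shifted q corner) {1, 3, 5}"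
    by (rule inj_on_inverseI[where g = segment]) (use shifted(2)[OF corner_in] q in auto)
  have corner_weight: "?w (shifted q corner) = (if colour \<sigma> q = colour \<sigma> (prev_segment q) then t else 1)"
    if "q \<in> {1, 3, 5}" for q
    using shifted(2)[OF corner_in q[OF that]] shifted_behind[OF corner_in q[OF that]] that
    unfolding weight_def colour_def by auto
  have "(\<Prod>v\<in>verts G. ?w v) = (\<Prod>v\<in>?C. ?w v)"
    using one C by (intro prod.mono_neutral_right finite_verts) auto
  also have "\<dots> = (\<Prod>q\<in>{1, 3, 5}. if colour \<sigma> q = colour \<sigma> (prev_segment q) then t else 1)"
    by (subst prod.reindex[OF inj]) (simp only: comp_def corner_weight cong: prod.cong)
  also have "\<dots> = (if colour \<sigma> 1 = colour \<sigma> 0 then t else 1) *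
      ((if colour \<sigma> 3 = colour \<sigma> 2 then t else 1) * (if colour \<sigma> 5 = colour \<sigma> 4 then t else 1))"
    by (simp add: prev_segment_def)
  \<comment> \<open>Copying identifies the colours of the segments 1, 3, 5 with those of 2, 4,
    0.\<close>
  also have "\<dots> = (if colour \<sigma> 2 = colour \<sigma> 0 then t else 1) *
      ((if colour \<sigma> 4 = colour \<sigma> 2 then t else 1) * (if colour \<sigma> 0 = colour \<sigma> 4 then t else 1))"
    using colour_copy[OF assms(2), of 2] colour_copy[OF assms(2), of 4] colour_wrap[OF assms(2)] Nc
    by (simp add: prev_segment_def)
  \<comment> \<open>With two colours on a cycle of three, one or all three of the pairs agree, which
    gives \<open>t\<close> or \<open>t\<close> cubed.\<close>
  also have "\<dots> = t * (if colour \<sigma> 0 = colour \<sigma> 2 \<and> colour \<sigma> 2 = colour \<sigma> 4 then t\<^sup>2 else 1)"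
    by (cases "colour \<sigma> 0"; cases "colour \<sigma> 2"; cases "colour \<sigma> 4") (simp_all add: power2_eq_square)
  finally show ?thesis using assms by (simp add: approx_state_def)
qed

lemma contract_weight:
  assumes \<sigma>: "\<sigma> \<in> configs G"
  shows "contract G (register_tensor (weight t)) \<sigma> = t * approx_state t \<sigma>"
proof (cases "entangled \<sigma>")
  case True
  then have le: "\<forall>v\<in>verts G. \<sigma> v \<le> d" by (simp add: entangled_def)
  show ?thesis unfolding contract_register[OF \<sigma>] if_P[OF le] by (rule prod_weight[OF \<sigma> True])
next
  case False
  have "(\<Prod>v\<in>verts G. weight t v (\<sigma> (behind lx v)) (\<sigma> v)) = 0" if le: "\<forall>v\<in>verts G. \<sigma> v \<le> d"
  proof (rule prod_zero[OF finite_verts])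
    obtain v where "v \<in> verts G" "segment v \<notin> {1, 3, 5}" "\<sigma> v \<noteq> \<sigma> (behind lx v)"
      using False le unfolding entangled_def by blast
    then show "\<exists>v\<in>verts G. weight t v (\<sigma> (behind lx v)) (\<sigma> v) = 0"
      unfolding weight_def by (intro bexI[of _ v]) auto
  qed
  then have "contract G (register_tensor (weight t)) \<sigma> = 0"
    unfolding contract_register[OF \<sigma>] by (simp only: if_cancel split: if_split) blast
  then show ?thesis using False by (simp add: approx_state_def)
qed

lemma approx_state_contract:
  assumes "t \<noteq> 0"
  shows "\<exists>A. approx_state t = contract G A"
proof -
  have "verts G \<noteq> {}" using corner_in by (auto simp: first_segment_def)
  from contract_smult[OF finite_verts this, of "1 / t" "register_tensor (weight t)"]
  obtain A where A: "contract G A = (\<lambda>\<sigma>. 1 / t * contract G (register_tensor (weight t)) \<sigma>)" ..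
  have "approx_state t \<sigma> = contract G A \<sigma>" for \<sigma>
  proof (cases "\<sigma> \<in> configs G")
    case True
    then show ?thesis using assms by (simp add: A contract_weight)
  next
    case False
    then show ?thesis by (simp add: approx_state_def contract_def)
  qed
  then show ?thesis by blast
qed


subsection \<open>The limit state\<close>

definition pieces :: "((nat \<Rightarrow> nat) \<Rightarrow> nat) set" where
  "pieces = (\<Pi>\<^sub>E z\<in>first_segment. {1..d})"

definition assemble :: "(nat \<Rightarrow> (nat \<Rightarrow> nat) \<Rightarrow> nat) \<Rightarrow> (nat \<Rightarrow> nat) \<Rightarrow> nat" where
  "assemble f = (\<lambda>v\<in>verts G. f (segment v) (offset v))"

text \<open>The letters of the three blocks: \<open>a\<close>, \<open>b\<close> on the segments 0
  and 1, \<open>b'\<close>, \<open>c\<close> on 2 and 3, \<open>c'\<close> on 4, and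
  \<open>a'\<close> on all later ones.\<close>

definition pattern :: "'s \<Rightarrow> 's \<Rightarrow> 's \<Rightarrow> 's \<Rightarrow> 's \<Rightarrow> 's \<Rightarrow> nat \<Rightarrow> 's" where
  "pattern a b b' c c' a' q =
    (if q = 0 then a else if q = 1 then b else if q = 2 then b' else if q = 3 then c
     else if q = 4 then c' else a')"

lemma assemble_in:
  assumes "\<And>q. f q \<in> pieces" "v \<in> verts G"
  shows "assemble f v \<in> {1..d}"
  using assms(1)[of "segment v"] offset_in[OF assms(2)] assms(2)
  by (auto simp: assemble_def pieces_def PiE_iff)

lemma assemble_configs:
  assumes "\<And>q. f q \<in> pieces"
  shows "assemble f \<in> configs G"
  unfolding configs_def
proof (rule PiE_I)
  fix v assume v: "v \<in> verts G"
  show "assemble f v \<in> {1..site_dim G v}"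
    using assemble_in[of f, OF assms v] site_dim[OF v] by auto
qed (simp add: assemble_def)

lemma assemble_shifted:
  "z \<in> first_segment \<Longrightarrow> q < 2 * Nc \<Longrightarrow> assemble f (shifted q z) = f q z"
  using shifted[of z q] by (simp add: assemble_def)

lemma entangled_assemble:
  assumes f: "\<And>q. f q \<in> pieces"
  shows "entangled (assemble f) \<longleftrightarrow> (\<forall>q<2 * Nc. q \<notin> {1, 3, 5} \<longrightarrow> f q = f (prev_segment q))"
proof
  assume ent: "entangled (assemble f)"
  show "\<forall>q<2 * Nc. q \<notin> {1, 3, 5} \<longrightarrow> f q = f (prev_segment q)"
  proof (intro allI impI)
    fix q assume q: "q < 2 * Nc" "q \<notin> {1, 3, 5}"
    have p: "prev_segment q < 2 * Nc" using q Nc by (auto simp: prev_segment_def)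
    have "f q z = f (prev_segment q) z" if z: "z \<in> first_segment" for z
    proof -
      have "assemble f (shifted q z) = assemble f (behind lx (shifted q z))"
        using ent q shifted(1,2)[OF z q(1)] unfolding entangled_def by metis
      then show ?thesis
        using assemble_shifted[OF z q(1)] assemble_shifted[OF z p] shifted_behind[OF z q(1)] by simp
    qed
    then show "f q = f (prev_segment q)"
      using f[of q] f[of "prev_segment q"] unfolding pieces_def by (rule PiE_ext[rotated 2])
  qed
next
  assume eq: "\<forall>q<2 * Nc. q \<notin> {1, 3, 5} \<longrightarrow> f q = f (prev_segment q)"
  show "entangled (assemble f)"
    unfolding entangled_def
  proof (intro conjI ballI impI)
    fix v assume v: "v \<in> verts G"
    show "assemble f v \<le> d" using assemble_in[OF f v] by simp
    assume "segment v \<notin> {1, 3, 5}"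
    then have "f (segment v) = f (prev_segment (segment v))"
      using eq segment_less[OF v] by blast
    moreover have "behind lx v \<in> verts G"
      using v L0_ge lx by (intro behind_in) auto
    ultimately show "assemble f v = assemble f (behind lx v)"
      using v behind_lx[OF v] by (simp add: assemble_def)
  qed
qed

lemma pattern_in: "{a, b, b', c, c', a'} \<subseteq> P \<Longrightarrow> pattern a b b' c c' a' q \<in> P"
  by (auto simp: pattern_def)

lemma pattern_copies:
  "(\<forall>q<2 * Nc. q \<notin> {1, 3, 5} \<longrightarrow> pattern a b b' c c' a' q = pattern a b b' c c' a' (prev_segment q))
    \<longleftrightarrow> b = b' \<and> c = c' \<and> a = a'" (is "(\<forall>q<_. _ \<longrightarrow> ?p q = ?p _) \<longleftrightarrow> _")
proof
  assume *: "\<forall>q<2 * Nc. q \<notin> {1, 3, 5} \<longrightarrow> ?p q = ?p (prev_segment q)"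
  have "?p 0 = ?p (prev_segment 0)" "?p 2 = ?p (prev_segment 2)" "?p 4 = ?p (prev_segment 4)"
    using * Nc by simp_all
  then show "b = b' \<and> c = c' \<and> a = a'" using Nc by (auto simp: pattern_def prev_segment_def)
next
  assume eq: "b = b' \<and> c = c' \<and> a = a'"
  show "\<forall>q<2 * Nc. q \<notin> {1, 3, 5} \<longrightarrow> ?p q = ?p (prev_segment q)"
  proof (intro allI impI)
    fix q assume q: "q < 2 * Nc" "q \<notin> {1, 3, 5}"
    \<comment> \<open>From segment 6 on, \<open>a'\<close> is compared with itself; only 0, 2 and 4
      compare different letters.\<close>
    then consider "q = 0" | "q = 2" | "q = 4" | "q \<ge> 6" by fastforce
    then show "?p q = ?p (prev_segment q)"
      by cases (use eq Nc in \<open>auto simp: pattern_def prev_segment_def\<close>)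
  qed
qed

text \<open>Brings the limit state into the form excluded by
  \<open>degenerate_ring_not_representable\<close>, the colour of a piece being read at its
  corner.\<close>

lemma approx_state_0_pattern:
  assumes P: "{a, b, b', c, c', a'} \<subseteq> pieces"
  shows "approx_state 0 (assemble (pattern a b b' c c' a')) =
    (if b = b' \<and> c = c' \<and> a = a' \<and>
       \<not> ((a corner = 1) = (b corner = 1) \<and> (b corner = 1) = (c corner = 1)) then 1 else 0)"
proof -
  let ?f = "pattern a b b' c c' a'"
  have f: "?f q \<in> pieces" for q using P by (rule pattern_in)
  have "entangled (assemble ?f) \<longleftrightarrow> b = b' \<and> c = c' \<and> a = a'"
    using entangled_assemble[OF f] pattern_copies by simp
  moreover have "colour (assemble ?f) 0 \<longleftrightarrow> a corner = 1" "colour (assemble ?f) 2 \<longleftrightarrow> b' corner = 1"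
    "colour (assemble ?f) 4 \<longleftrightarrow> c' corner = 1"
    using Nc assemble_shifted[OF corner_in] by (simp_all add: colour_def pattern_def)
  ultimately show ?thesis
    using assemble_configs[OF f] unfolding approx_state_def by auto
qed

section \<open>Counting pieces and bond configurations\<close>

definition layer_size :: nat where
  "layer_size = card {v \<in> verts G. v 0 = 1}"

lemma card_layer:
  assumes "1 \<le> x" "x \<le> L 0"
  shows "card {v \<in> verts G. v 0 = x} = layer_size"
  unfolding layer_size_def
proof (rule bij_betw_same_card)
  show "bij_betw (\<lambda>v. v(0 := 1)) {v \<in> verts G. v 0 = x} {v \<in> verts G. v 0 = 1}"
    by (rule bij_betw_byWitness[where f' = "\<lambda>v. v(0 := x)"])
      (use assms L0_pos in \<open>auto simp: verts_upd fun_upd_idem\<close>)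
qed

lemma finite_first_segment: "finite first_segment"
  using finite_verts by (simp add: first_segment_def)

lemma card_first_segment: "card first_segment = lx * layer_size"
proof -
  have "first_segment = (\<Union>x\<in>{1..lx}. {v \<in> verts G. v 0 = x})"
    using verts_coord0 by (auto simp: first_segment_def)
  also have "card \<dots> = (\<Sum>x\<in>{1..lx}. card {v \<in> verts G. v 0 = x})"
    using finite_verts by (intro card_UN_disjoint) auto
  also have "\<dots> = (\<Sum>x\<in>{1..lx}. layer_size)"
    using L0_ge by (intro sum.cong card_layer) auto
  finally show ?thesis by simp
qed

lemma card_pieces: "card pieces = d ^ (lx * layer_size)"
  using finite_first_segment by (simp add: pieces_def card_PiE card_first_segment)

lemma edge_configs_fwd:
  assumes "1 \<le> x" "x \<le> L 0" "C = fwd ` {v \<in> verts G. v 0 = x}"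
  shows "card (edge_configs G C) = card pieces" "finite (edge_configs G C)"
proof -
  have fin: "finite C" using finite_verts assms by simp
  have "card C = layer_size"
    unfolding assms(3) card_layer[OF assms(1,2), symmetric]
    by (intro card_image inj_on_subset[OF fwd_inj]) auto
  moreover have "bond_dim G e = d ^ lx" if "e \<in> C" for e
    using that assms(3) bond_dim_x fwd_edge_x by auto
  ultimately show "card (edge_configs G C) = card pieces"
    using fin by (simp add: edge_configs_def card_PiE card_pieces power_mult)
  show "finite (edge_configs G C)"
    using fin by (simp add: edge_configs_def finite_PiE)
qed

section \<open>Cuts between blocks of consecutive layers\<close>

definition block :: "nat \<Rightarrow> nat \<Rightarrow> (nat \<Rightarrow> nat) set" where
  "block p q = {v \<in> verts G. p < v 0 \<and> v 0 \<le> q}"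

lemma ahead_0: "ahead v 0 = (if v 0 = L 0 then 1 else v 0 + 1)"
  by (simp add: ahead_def)

lemma cut_blockD:
  assumes "e \<in> cut G (block p q) (block p' q')" "q \<le> p' \<or> q' \<le> p"
  shows "\<exists>v\<in>verts G. e = fwd v \<and> (p < v 0 \<and> v 0 \<le> q \<and> p' < ahead v 0 \<and> ahead v 0 \<le> q'
        \<or> p < ahead v 0 \<and> ahead v 0 \<le> q \<and> p' < v 0 \<and> v 0 \<le> q')"
proof -
  have "e \<in> edges G" using assms by (simp add: cut_def)
  then show ?thesis
  proof (cases rule: edge_cases)
    case (1 v)
    then show ?thesis using assms by (intro bexI[of _ v]) (auto simp: cut_def block_def fwd_def)
  next
    case (2 v w)
    then show ?thesis using assms by (auto simp: cut_def block_def)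
  qed
qed

text \<open>The condition \<open>0 < p \<or> r < L 0\<close> rules out that the two blocks also meet
  around the ring.\<close>

lemma cut_block_adjacent:
  assumes "p < q" "q < r" "r \<le> L 0" "0 < p \<or> r < L 0"
  shows "cut G (block p q) (block q r) = fwd ` {v \<in> verts G. v 0 = q}"
proof (intro equalityI subsetI)
  fix e assume "e \<in> cut G (block p q) (block q r)"
  from cut_blockD[OF this] obtain v where v: "v \<in> verts G" "e = fwd v"
      "p < v 0 \<and> v 0 \<le> q \<and> q < ahead v 0 \<and> ahead v 0 \<le> r
        \<or> p < ahead v 0 \<and> ahead v 0 \<le> q \<and> q < v 0 \<and> v 0 \<le> r" by blast
  then have "v 0 = q" using assms unfolding ahead_0 by (cases "v 0 = L 0") auto
  with v show "e \<in> fwd ` {v \<in> verts G. v 0 = q}" by blast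
next
  fix e assume "e \<in> fwd ` {v \<in> verts G. v 0 = q}"
  then obtain v where v: "v \<in> verts G" "v 0 = q" "e = fwd v" by blast
  then have "v \<in> block p q" "ahead v \<in> block q r"
    using assms ahead_in[of v] by (auto simp: block_def ahead_0)
  then show "e \<in> cut G (block p q) (block q r)"
    using v fwd_edge[of v] by (auto simp: cut_def fwd_def)
qed

lemma cut_block_wrap:
  assumes "0 < p" "p < q" "q < L 0"
  shows "cut G (block q (L 0)) (block 0 p) = fwd ` {v \<in> verts G. v 0 = L 0}"
proof (intro equalityI subsetI)
  fix e assume "e \<in> cut G (block q (L 0)) (block 0 p)"
  from cut_blockD[OF this] obtain v where v: "v \<in> verts G" "e = fwd v"
      "q < v 0 \<and> v 0 \<le> L 0 \<and> 0 < ahead v 0 \<and> ahead v 0 \<le> p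
        \<or> q < ahead v 0 \<and> ahead v 0 \<le> L 0 \<and> 0 < v 0 \<and> v 0 \<le> p"
    using assms by auto
  then have "v 0 = L 0" using assms unfolding ahead_0 by (cases "v 0 = L 0") auto
  with v show "e \<in> fwd ` {v \<in> verts G. v 0 = L 0}" by blast
next
  fix e assume "e \<in> fwd ` {v \<in> verts G. v 0 = L 0}"
  then obtain v where v: "v \<in> verts G" "v 0 = L 0" "e = fwd v" by blast
  then have "v \<in> block q (L 0)" "ahead v \<in> block 0 p"
    using assms ahead_in[of v] by (auto simp: block_def ahead_0)
  then show "e \<in> cut G (block q (L 0)) (block 0 p)"
    using v fwd_edge[of v] by (auto simp: cut_def fwd_def)
qed

lemma segment_block:
  assumes "v \<in> block (p * lx) (q * lx)"
  shows "p \<le> segment v" "segment v < q"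
proof -
  have "p * lx \<le> v 0 - 1" "v 0 - 1 < q * lx" using assms by (auto simp: block_def)
  then show "p \<le> segment v" "segment v < q"
    using lx by (simp_all add: segment_def less_mult_imp_div_less less_eq_div_iff_mult_less_eq)
qed

text \<open>The blocks hold the segments 0 and 1, 2 and 3, and all the rest, so each block tensor
  sees two letters of a pattern, and a contraction would realize the excluded ring.\<close>

lemma approx_state_0_not_contract: "approx_state 0 \<noteq> contract G A"
proof
  assume A: "approx_state 0 = contract G A"
  let ?V1 = "block (0 * lx) (2 * lx)" and ?V2 = "block (2 * lx) (4 * lx)"
    and ?V3 = "block (4 * lx) (2 * Nc * lx)"
  let ?Ca = "cut G ?V3 ?V1" and ?Cb = "cut G ?V1 ?V2" and ?Cc = "cut G ?V2 ?V3"
  have bounds: "0 < lx" "2 * lx < 4 * lx" "4 * lx < L 0" using lx L0_ge by linarith+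
  have cuts: "?Ca = fwd ` {v \<in> verts G. v 0 = L 0}" "?Cb = fwd ` {v \<in> verts G. v 0 = 2 * lx}"
      "?Cc = fwd ` {v \<in> verts G. v 0 = 4 * lx}"
    using cut_block_wrap[of "2 * lx" "4 * lx"] cut_block_adjacent[of 0 "2 * lx" "4 * lx"]
      cut_block_adjacent[of "2 * lx" "4 * lx" "L 0"] bounds by (simp_all add: L0)
  \<comment> \<open>Letters outside the block are filled with letters at hand, so that each tensor
    depends on two pieces only.\<close>
  define B1 where "B1 a b = block_tensor G A ?V1 ?Ca (assemble (pattern a b b b b b))" for a b
  define B2 where "B2 b c = block_tensor G A ?V2 ?Cb (assemble (pattern b b b c c c))" for b c
  define B3 where "B3 c a = block_tensor G A ?V3 ?Cc (assemble (pattern c c c c c a))" for c a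
  show False
  proof (rule degenerate_ring_not_representable[where S = pieces and I = "edge_configs G ?Ca"
        and J = "edge_configs G ?Cb" and K = "edge_configs G ?Cc" and \<phi> = "\<lambda>a. a corner = 1"
        and ?a0.0 = "\<lambda>z\<in>first_segment. 1" and ?a1.0 = "\<lambda>z\<in>first_segment. 2"
        and \<kappa> = 1 and ?B1.0 = B1 and ?B2.0 = B2 and ?B3.0 = B3])
    show "finite pieces"
      using finite_first_segment by (simp add: pieces_def finite_PiE)
    show "finite (edge_configs G ?Ca)" "card (edge_configs G ?Ca) = card pieces"
      using edge_configs_fwd[OF _ _ cuts(1)] bounds by auto
    show "finite (edge_configs G ?Cb)" "card (edge_configs G ?Cb) = card pieces"
      using edge_configs_fwd[OF _ _ cuts(2)] bounds by auto
    show "finite (edge_configs G ?Cc)" "card (edge_configs G ?Cc) = card pieces"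
      using edge_configs_fwd[OF _ _ cuts(3)] bounds by auto
    \<comment> \<open>Two pieces of different colours, available because
      \<open>d \<ge> 2\<close>.\<close>
    show "(\<lambda>z\<in>first_segment. 1) \<in> pieces" "(\<lambda>z\<in>first_segment. 2) \<in> pieces"
      using d by (auto simp: pieces_def)
    show "(((\<lambda>z\<in>first_segment. 1) corner :: nat) = 1) \<noteq> (((\<lambda>z\<in>first_segment. 2) corner :: nat) = 1)"
      using corner_in by simp
    show "(1 :: complex) \<noteq> 0" by simp
    fix a b b' c c' a' assume P: "{a, b, b', c, c', a'} \<subseteq> pieces"
    let ?\<sigma> = "assemble (pattern a b b' c c' a')"
    have \<sigma>: "?\<sigma> \<in> configs G" using pattern_in[OF P] by (rule assemble_configs)
    have V: "verts G = ?V1 \<union> ?V2 \<union> ?V3" "?V1 \<inter> ?V2 = {}" "?V2 \<inter> ?V3 = {}" "?V1 \<inter> ?V3 = {}"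
    proof -
      have "0 < v 0" "v 0 \<le> 2 * Nc * lx" if "v \<in> verts G" for v
        using verts_coord0[OF that] L0 by simp_all
      then show "verts G = ?V1 \<union> ?V2 \<union> ?V3" by (auto simp: block_def)
    qed (auto simp: block_def)
    have "B1 a b = block_tensor G A ?V1 ?Ca ?\<sigma>"
      unfolding B1_def
      by (intro block_tensor_cong, drule segment_block(2)) (simp add: assemble_def pattern_def)
    moreover have "B2 b' c = block_tensor G A ?V2 ?Cb ?\<sigma>"
      unfolding B2_def
      by (intro block_tensor_cong, frule segment_block(1), drule segment_block(2))
        (simp add: assemble_def pattern_def)
    moreover have "B3 c' a' = block_tensor G A ?V3 ?Cc ?\<sigma>"
      unfolding B3_def
      by (intro block_tensor_cong, drule segment_block(1)) (simp add: assemble_def pattern_def)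
    ultimately have "ring_sum (edge_configs G ?Ca) (edge_configs G ?Cb) (edge_configs G ?Cc)
        (B1 a b) (B2 b' c) (B3 c' a') = contract G A ?\<sigma>"
      using contract_three_blocks[OF network V \<sigma>] by simp
    also have "\<dots> = (if b = b' \<and> c = c' \<and> a = a' \<and>
       \<not> ((a corner = 1) = (b corner = 1) \<and> (b corner = 1) = (c corner = 1)) then 1 else 0)"
      unfolding A[symmetric] by (rule approx_state_0_pattern[OF P])
    finally show "ring_sum (edge_configs G ?Ca) (edge_configs G ?Cb) (edge_configs G ?Cc)
        (B1 a b) (B2 b' c) (B3 c' a') = \<dots>" .
  qed
qed

section \<open>Passage to the limit\<close>

lemma PEPS_not_closed: "\<not> closedin (norm_topology G) (PEPS G)"
proof
  assume closed: "closedin (norm_topology G) (PEPS G)"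
  \<comment> \<open>Nonzero parameters that tend to 0; at each of them the state is a
    contraction.\<close>
  define t :: "nat \<Rightarrow> complex" where "t n = 1 / of_nat (Suc n)" for n
  have "t \<longlonglongrightarrow> 0" unfolding t_def using LIMSEQ_inverse_real_of_nat
    by (simp add: tendsto_of_real_iff[symmetric, where 'a = complex] divide_inverse)
  then have t: "(\<lambda>n. (t n)\<^sup>2) \<longlonglongrightarrow> 0\<^sup>2" by (rule tendsto_power)
  have "\<exists>A. approx_state 0 = contract G A"
  proof (rule PEPS_closed_limit[OF network closed])
    show "\<exists>A. approx_state (t n) = contract G A" for n
      by (rule approx_state_contract) (simp add: t_def del: of_nat_Suc)
    show "(\<lambda>n. approx_state (t n) \<sigma>) \<longlonglongrightarrow> approx_state 0 \<sigma>" for \<sigma>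
      using t unfolding approx_state_def by (auto simp del: power_zero_numeral)
    show "approx_state 0 \<in> state_space G"
      by (simp add: state_space_def approx_state_def)
    \<comment> \<open>A copied pattern of mixed colours has amplitude 1, so the limit is not
      0.\<close>
    let ?a = "\<lambda>z\<in>first_segment. 1" and ?b = "\<lambda>z\<in>first_segment. 2"
    have "approx_state 0 (assemble (pattern ?a ?b ?b ?b ?b ?a)) = 1"
      using approx_state_0_pattern[of ?a ?b ?b ?b ?b ?a] d corner_in by (simp add: pieces_def)
    then show "approx_state 0 \<noteq> (\<lambda>_. 0)" by (intro notI) simp
  qed
  then show False using approx_state_0_not_contract by blast
qed

end

theorem proposition8:
  fixes D d lx Nc :: nat
    and L m :: "nat \<Rightarrow> nat" and per :: "nat \<Rightarrow> bool"
    and G :: "(nat \<Rightarrow> nat) network"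
  assumes "D \<ge> 1" and "d \<ge> 2" and "lx \<ge> 1" and "Nc \<ge> 3"
    and "tensor_network G"
    and "verts G = lattice_verts D L"
    and "edges G = lattice_edges D L per"
    and "\<forall>i\<in>verts G. site_dim G i \<ge> d"
    and "per 0"
    and "L 0 = 2 * Nc * lx"
    and "\<forall>e\<in>lattice_edges_dir D L per 0. bond_dim G e = d ^ lx"
    and "\<forall>k\<in>{1..<D}. L k \<ge> 1"
    and "\<forall>k\<in>{1..<D}. m k \<ge> 2 \<and> (\<forall>e\<in>lattice_edges_dir D L per k. bond_dim G e = m k)"
  shows "\<not> closedin (norm_topology G) (PEPS G)"
proof -
  interpret ring_lattice D d lx Nc L per G
    using assms by unfold_locales auto
  show ?thesis by (rule PEPS_not_closed)
qed

end
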